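(* Let $E\subset L_1(0,\infty)$ be a symmetric Banach space on the semi-axis $(0,\infty)$. For every given $0\le x\in E$, there exists a singular symmetric linear functional $\varphi_{sing}$ on $E$ such that $$\varphi_{sing}(x)=\lim_{m\to\infty}\frac1m\|\sigma_m(\mu(x))\chi_{(0,1)}\|_E.$$
   Context: For a measurable function $x$ on $(0,\infty)$, $\mu(t,x)=\inf\{s\ge0:\ |\{|x|>s\}|\le t\}$ (Lebesgue measure) is its decreasing rearrangement. A symmetric Banach space $E$ on $(0,\infty)$ is a Banach space of (real-valued) functions $E\subset(L_1+L_\infty)(0,\infty)$ such that: (a) $x\in E$, $y\in L_1+L_\infty$, $\mu(y)=\mu(x)$ imply $y\in E$ and $\|y\|_E=\|x\|_E$; (b) $0\le y\le x\in E$ implies $y\in E$ and $\|y\|_E\le\|x\|_E$. The dilation operator is $(\sigma_mx)(t)=x(t/m)$, $t>0$. A linear functional $\varphi$ on $E$ is symmetric if $\varphi(y)=\varphi(x)$ for all $0\le x,y\in E$ with $\mu(y)=\mu(x)$, and singular if $\varphi=0$ on $(L_1\cap L_\infty)(0,\infty)$. *)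

theory Defs
  imports "HOL-Analysis.Analysis"
begin

text \<open>
  Measurable functions on the semi-axis are represented by functions on the whole real line; only
  their values on \<open>{0<..}\<close> matter. Equivalence classes modulo null sets are not formed: a function
  space is a set of representatives that is closed under almost everywhere equality, and its norm
  vanishes exactly on the null functions.
\<close>

abbreviation semiaxis :: "real measure" where
  "semiaxis \<equiv> lebesgue_on {0<..}"

definition L1 :: "(real \<Rightarrow> real) set" where
  "L1 = {x. integrable semiaxis x}"

definition Linf :: "(real \<Rightarrow> real) set" where
  "Linf = {x \<in> borel_measurable semiaxis. \<exists>C. AE t in semiaxis. \<bar>x t\<bar> \<le> C}"

definition L1_plus_Linf :: "(real \<Rightarrow> real) set" where
  "L1_plus_Linf = {x \<in> borel_measurable semiaxis.
     \<exists>g\<in>L1. \<exists>h\<in>Linf. AE t in semiaxis. x t = g t + h t}"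

text \<open>
  For \<open>x \<in> L1_plus_Linf\<close> and \<open>t > 0\<close> the infimum is over a nonempty set; other values are irrelevant.
\<close>

definition rearr :: "(real \<Rightarrow> real) \<Rightarrow> real \<Rightarrow> real" where
  "rearr x t = Inf {s. 0 \<le> s \<and> emeasure semiaxis {u \<in> space semiaxis. \<bar>x u\<bar> > s} \<le> ennreal t}"

definition equimeasurable :: "(real \<Rightarrow> real) \<Rightarrow> (real \<Rightarrow> real) \<Rightarrow> bool" where
  "equimeasurable x y \<longleftrightarrow> (\<forall>t>0. rearr x t = rearr y t)"

definition dilation :: "real \<Rightarrow> (real \<Rightarrow> real) \<Rightarrow> real \<Rightarrow> real" where
  "dilation m x = (\<lambda>t. x (t / m))"

definition normed_function_space :: "(real \<Rightarrow> real) set \<Rightarrow> ((real \<Rightarrow> real) \<Rightarrow> real) \<Rightarrow> bool" where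
  "normed_function_space E N \<longleftrightarrow>
     E \<subseteq> borel_measurable semiaxis \<and>
     (\<lambda>t. 0) \<in> E \<and>
     (\<forall>x\<in>E. \<forall>y\<in>E. (\<lambda>t. x t + y t) \<in> E) \<and>
     (\<forall>c. \<forall>x\<in>E. (\<lambda>t. c * x t) \<in> E) \<and>
     (\<forall>x\<in>E. \<forall>y\<in>borel_measurable semiaxis. (AE t in semiaxis. y t = x t) \<longrightarrow> y \<in> E) \<and>
     (\<forall>x\<in>E. 0 \<le> N x) \<and>
     (\<forall>x\<in>E. N x = 0 \<longleftrightarrow> (AE t in semiaxis. x t = 0)) \<and>
     (\<forall>c. \<forall>x\<in>E. N (\<lambda>t. c * x t) = \<bar>c\<bar> * N x) \<and>
     (\<forall>x\<in>E. \<forall>y\<in>E. N (\<lambda>t. x t + y t) \<le> N x + N y)"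

definition banach_function_space :: "(real \<Rightarrow> real) set \<Rightarrow> ((real \<Rightarrow> real) \<Rightarrow> real) \<Rightarrow> bool" where
  "banach_function_space E N \<longleftrightarrow>
     normed_function_space E N \<and>
     (\<forall>X :: nat \<Rightarrow> real \<Rightarrow> real.
        (\<forall>n. X n \<in> E) \<and>
        (\<forall>e>0. \<exists>K. \<forall>m\<ge>K. \<forall>n\<ge>K. N (\<lambda>t. X m t - X n t) < e) \<longrightarrow>
        (\<exists>x\<in>E. (\<lambda>n. N (\<lambda>t. X n t - x t)) \<longlonglongrightarrow> 0))"

definition symmetric_banach_space :: "(real \<Rightarrow> real) set \<Rightarrow> ((real \<Rightarrow> real) \<Rightarrow> real) \<Rightarrow> bool" where
  "symmetric_banach_space E N \<longleftrightarrow>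
     banach_function_space E N \<and>
     E \<subseteq> L1_plus_Linf \<and>
     (\<forall>x\<in>E. \<forall>y\<in>L1_plus_Linf. equimeasurable y x \<longrightarrow> y \<in> E \<and> N y = N x) \<and>
     (\<forall>x\<in>E. \<forall>y\<in>borel_measurable semiaxis.
        (AE t in semiaxis. 0 \<le> y t \<and> y t \<le> x t) \<longrightarrow> y \<in> E \<and> N y \<le> N x)"

definition linear_functional_on :: "(real \<Rightarrow> real) set \<Rightarrow> ((real \<Rightarrow> real) \<Rightarrow> real) \<Rightarrow> bool" where
  "linear_functional_on E \<phi> \<longleftrightarrow>
     (\<forall>x\<in>E. \<forall>y\<in>E. (AE t in semiaxis. x t = y t) \<longrightarrow> \<phi> x = \<phi> y) \<and>
     (\<forall>x\<in>E. \<forall>y\<in>E. \<phi> (\<lambda>t. x t + y t) = \<phi> x + \<phi> y) \<and>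
     (\<forall>c. \<forall>x\<in>E. \<phi> (\<lambda>t. c * x t) = c * \<phi> x)"

definition symmetric_functional_on :: "(real \<Rightarrow> real) set \<Rightarrow> ((real \<Rightarrow> real) \<Rightarrow> real) \<Rightarrow> bool" where
  "symmetric_functional_on E \<phi> \<longleftrightarrow>
     (\<forall>x\<in>E. \<forall>y\<in>E. (AE t in semiaxis. 0 \<le> x t) \<and> (AE t in semiaxis. 0 \<le> y t) \<and>
        equimeasurable y x \<longrightarrow> \<phi> y = \<phi> x)"

text \<open>
  The intersection with \<open>E\<close> below only matters for the zero space: every nonzero symmetric Banach
  space contains \<open>L1 \<inter> Linf\<close>.
\<close>

definition singular_functional_on :: "(real \<Rightarrow> real) set \<Rightarrow> ((real \<Rightarrow> real) \<Rightarrow> real) \<Rightarrow> bool" where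
  "singular_functional_on E \<phi> \<longleftrightarrow> (\<forall>y \<in> E \<inter> (L1 \<inter> Linf). \<phi> y = 0)"

end

theory Submission
  imports Defs "HOL-Library.Function_Algebras"
begin

text \<open>
  Write \<open>d\<^sub>u(s)\<close> for the measure of \<open>{|u| > s}\<close>, and \<open>a\<^sub>m\<close> for the norm of \<open>\<sigma>\<^sub>m(\<mu>(x))\<chi>\<close> with
  \<open>\<chi>\<close> the indicator of the unit interval. The required properties of the functional are all linear
  conditions, so its existence is a question of linear algebra. Let \<open>Z\<close> be the span of all differences
  \<open>u - v\<close> of nonnegative equimeasurable elements of \<open>E\<close> together with the elements of \<open>E\<close> that lie in
  \<open>L1\<close> and \<open>Linf\<close>. A linear functional that vanishes on \<open>Z\<close> is symmetric and singular. If \<open>x\<close> is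
  outside \<open>Z\<close>, its value at \<open>x\<close> can be prescribed freely. So it suffices to show two facts: the
  limit \<open>L\<close> of \<open>a\<^sub>m / m\<close> exists, and \<open>L = 0\<close> whenever \<open>x\<close> is in \<open>Z\<close>.

  The limit exists and equals the infimum of \<open>a\<^sub>m / m\<close>, because \<open>a\<^sub>n \<le> k a\<^sub>m\<close> for \<open>n \<le> k m\<close>: the
  dilation by \<open>k\<close> has the distribution of \<open>k\<close> disjoint copies, whose norm the triangle inequality
  bounds (\<open>dilated_rearr_limit\<close>).

  For \<open>x\<close> in \<open>Z\<close>, moving negative terms to the left gives
  \<open>x + v\<^sub>1 + \<dots> + v\<^sub>n = u\<^sub>1 + \<dots> + u\<^sub>n + z\<close> with nonnegative \<open>u\<^sub>i\<close> and \<open>v\<^sub>i\<close> that are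
  equimeasurable, and \<open>z\<close> bounded. For a suitable integer \<open>q\<close> and all large \<open>s\<close>, the integrals above
  level \<open>s\<close> satisfy
  \<open>\<integral>(x - s)\<^sub>+ + \<Sum> \<integral>(v\<^sub>i - s)\<^sub>+ \<le> \<Sum> \<integral>(u\<^sub>i - s/q)\<^sub>+\<close>.
  Here \<open>v\<^sub>i\<close> may be replaced by \<open>u\<^sub>i\<close>, and these integrals are finite because \<open>E\<close> is contained in
  \<open>L1\<close>; cancelling them gives \<open>\<integral>(x - s)\<^sub>+ \<le> s \<Sum>\<^sub>i d(u\<^sub>i, s/q)\<close>. Bounding the left side below by a
  geometric sequence of levels yields \<open>\<Sum>\<^sub>i q\<^sup>i d\<^sub>x(q\<^sup>i s) \<le> d\<^sub>Y(s)\<close> for a single \<open>Y\<close> in \<open>E\<close>, for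
  large \<open>s\<close> and with any number of summands (\<open>levels_le_of_balance\<close>, \<open>balanced_levels_le\<close>).

  The left side is the distribution function of a disjoint sum, whose \<open>i\<close>-th term is \<open>q\<^sup>-\<^sup>i\<close> times the
  dilation of \<open>x\<close> by \<open>q\<^sup>i\<close>. Replacing a function by the average of \<open>q\<close> disjoint copies of it does not
  increase the norm (\<open>averaging\<close>); applied repeatedly, this turns the terms \<open>i = 0, \<dots>, r\<close> all into the
  last one (\<open>flattening\<close>). Hence \<open>r + 1\<close> disjoint copies of \<open>q\<^sup>-\<^sup>r\<close> times the dilation by \<open>q\<^sup>r\<close> of the
  large part of \<open>x\<close> have norm at most that of \<open>Y\<close>, whence \<open>a\<^sub>m / m = O(1/(r + 1))\<close> for
  \<open>m = (r + 1) q\<^sup>r\<close>, and \<open>L = 0\<close> (\<open>balanced_limit_zero\<close>).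
\<close>

section \<open>Distribution functions and rearrangements\<close>

definition distribution :: "(real \<Rightarrow> real) \<Rightarrow> real \<Rightarrow> ennreal" where
  "distribution u s = emeasure semiaxis {t \<in> space semiaxis. \<bar>u t\<bar> > s}"

text \<open>
  Translated rearrangements are the building blocks of disjoint sums: \<open>place a u\<close> has the distribution
  function of \<open>u\<close>, and its superlevel sets are intervals starting at \<open>a\<close>.
\<close>

definition place :: "real \<Rightarrow> (real \<Rightarrow> real) \<Rightarrow> real \<Rightarrow> real" where
  "place a u t = (if a < t then rearr u (t - a) else 0)"

lemma L1_measurable: "u \<in> L1 \<Longrightarrow> u \<in> borel_measurable semiaxis"
  by (auto simp: L1_def)

lemma sets_superlevel:
  fixes u :: "real \<Rightarrow> real"
  assumes "u \<in> borel_measurable semiaxis"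
  shows "{t \<in> space semiaxis. \<bar>u t\<bar> > s} \<in> sets semiaxis"
proof -
  have "(\<lambda>t. \<bar>u t\<bar>) \<in> borel_measurable semiaxis"
    using assms by measurable
  then show ?thesis by (subst (asm) borel_measurable_iff_greater) blast
qed

lemma sets_semiaxis_interval:
  "{t \<in> space semiaxis. a < t \<and> ennreal (t - a) < d} \<in> sets semiaxis"
proof -
  have "{t \<in> space semiaxis. a < t \<and> ennreal (t - a) < d}
      = {t \<in> space borel. 0 < t \<and> a < t \<and> ennreal (t - a) < d}" by auto
  also have "\<dots> \<in> sets borel" by measurable
  finally show ?thesis by (subst sets_restrict_space_iff) auto
qed

lemma emeasure_semiaxis_interval:
  assumes "0 \<le> a"
  shows "emeasure semiaxis {t \<in> space semiaxis. a < t \<and> ennreal (t - a) < d} = d"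
    (is "emeasure _ ?A = d")
proof -
  have "emeasure semiaxis ?A = emeasure lebesgue ?A"
    by (subst emeasure_restrict_space) auto
  also have "\<dots> = d"
  proof (cases d)
    case (real r)
    have "?A = {a<..<a + r}"
      using assms real by (auto simp: ennreal_less_iff)
    then show ?thesis using real by simp
  next
    case top
    have A: "?A = {a<..}"
      using assms top by auto
    have "emeasure lborel {a<..} = \<infinity>"
    proof (rule ccontr)
      assume ne: "emeasure lborel {a<..} \<noteq> \<infinity>"
      define r where "r = enn2real (emeasure lborel {a<..})"
      have r: "emeasure lborel {a<..} = ennreal r" "0 \<le> r"
        using ne by (auto simp: r_def less_top)
      have "emeasure lborel {a<..<a + (r + 1)} \<le> emeasure lborel {a<..}"
        by (rule emeasure_mono) auto
      then show False using r by simp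
    qed
    then show ?thesis using A top by simp
  qed
  finally show ?thesis .
qed

lemma distribution_antimono:
  assumes "u \<in> borel_measurable semiaxis" "s \<le> s'"
  shows "distribution u s' \<le> distribution u s"
  unfolding distribution_def
  by (rule emeasure_mono[OF _ sets_superlevel[OF assms(1)]]) (use assms(2) in auto)

text \<open>
  Together with monotonicity this is right continuity of the distribution function, which makes the
  infimum that defines the rearrangement a genuine generalized inverse.
\<close>

lemma distribution_right_continuous:
  assumes u: "u \<in> borel_measurable semiaxis" and t: "t < distribution u s"
  shows "\<exists>s'>s. t < distribution u s'"
proof -
  let ?A = "\<lambda>n. {t \<in> space semiaxis. \<bar>u t\<bar> > s + 1 / real (Suc n)}"
  have "(\<Union>n. ?A n) = {t \<in> space semiaxis. \<bar>u t\<bar> > s}"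
  proof (intro subset_antisym subsetI)
    fix w assume "w \<in> {t \<in> space semiaxis. \<bar>u t\<bar> > s}"
    then have w: "0 < w" "\<bar>u w\<bar> - s > 0" by auto
    then obtain n where "inverse (real (Suc n)) < \<bar>u w\<bar> - s"
      using reals_Archimedean by blast
    then show "w \<in> (\<Union>n. ?A n)" using w by (auto simp: inverse_eq_divide intro!: exI[of _ n])
  next
    fix w assume "w \<in> (\<Union>n. ?A n)"
    then obtain n where n: "w \<in> ?A n" by blast
    have "0 < 1 / real (Suc n)" by simp
    with n have "s < \<bar>u w\<bar>" by (smt (verit) mem_Collect_eq)
    with n show "w \<in> {t \<in> space semiaxis. \<bar>u t\<bar> > s}" by auto
  qed
  moreover have "(SUP n. emeasure semiaxis (?A n)) = emeasure semiaxis (\<Union>n. ?A n)"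
  proof (rule SUP_emeasure_incseq)
    show "range ?A \<subseteq> sets semiaxis" using sets_superlevel[OF u] by blast
    show "incseq ?A"
    proof (rule incseq_SucI, rule subsetI)
      fix n w assume w: "w \<in> ?A n"
      have "1 / real (Suc (Suc n)) \<le> 1 / real (Suc n)" by (simp add: field_simps)
      with w show "w \<in> ?A (Suc n)" by (smt (verit) mem_Collect_eq)
    qed
  qed
  ultimately have "distribution u s = (SUP n. distribution u (s + 1 / real (Suc n)))"
    by (simp add: distribution_def)
  with t obtain n where "t < distribution u (s + 1 / real (Suc n))"
    by (auto simp: less_SUP_iff)
  then show ?thesis by (intro exI[of _ "s + 1 / real (Suc n)"]) auto
qed

lemma L1_nn_integral:
  assumes "u \<in> borel_measurable semiaxis"
  shows "u \<in> L1 \<longleftrightarrow> (\<integral>\<^sup>+ t. ennreal \<bar>u t\<bar> \<partial>semiaxis) < \<infinity>"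
  using assms by (simp add: L1_def integrable_iff_bounded)

lemma distribution_Markov:
  assumes u: "u \<in> borel_measurable semiaxis" and s: "0 < s"
  shows "ennreal s * distribution u s \<le> (\<integral>\<^sup>+ t. ennreal \<bar>u t\<bar> \<partial>semiaxis)"
proof -
  have "ennreal s * distribution u s
        = (\<integral>\<^sup>+ t. ennreal s * indicator {t \<in> space semiaxis. \<bar>u t\<bar> > s} t \<partial>semiaxis)"
    unfolding distribution_def by (rule nn_integral_cmult_indicator[symmetric, OF sets_superlevel[OF u]])
  also have "\<dots> \<le> (\<integral>\<^sup>+ t. ennreal \<bar>u t\<bar> \<partial>semiaxis)"
    by (rule nn_integral_mono) (use s in \<open>auto simp: indicator_def intro!: ennreal_leI\<close>)
  finally show ?thesis .
qed

lemma distribution_finite: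
  assumes "u \<in> L1" and "0 < s"
  shows "distribution u s < \<infinity>"
proof -
  have "ennreal s * distribution u s < \<infinity>"
    using distribution_Markov[OF L1_measurable[OF assms(1)] assms(2)] assms(1)
      L1_nn_integral[OF L1_measurable[OF assms(1)]] by (simp add: le_less_trans)
  then show ?thesis using assms(2) by (auto simp: ennreal_mult_less_top)
qed

lemma distribution_small:
  assumes "u \<in> L1" and "0 < t"
  shows "\<exists>s\<ge>0. distribution u s \<le> ennreal t"
proof -
  let ?I = "\<integral>\<^sup>+ t. ennreal \<bar>u t\<bar> \<partial>semiaxis"
  have "?I < \<infinity>" using assms(1) L1_nn_integral[OF L1_measurable[OF assms(1)]] by simp
  then obtain I where I: "?I = ennreal I" "0 \<le> I" by (cases ?I) auto
  define s where "s = I / t + 1"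
  have s: "s > 0" using I assms(2) by (simp add: s_def add_nonneg_pos)
  obtain d where d: "distribution u s = ennreal d" "0 \<le> d"
    using distribution_finite[OF assms(1) s] by (cases "distribution u s") auto
  have "ennreal s * ennreal d \<le> ennreal I"
    using distribution_Markov[OF L1_measurable[OF assms(1)] s] I d by simp
  then have "s * d \<le> I" using s d I by (simp add: ennreal_mult[symmetric])
  moreover have "I \<le> s * t" using assms(2) by (simp add: s_def field_simps)
  ultimately have "d \<le> t" using s by (smt (verit) mult_le_cancel_left_pos)
  then show ?thesis using s d by (intro exI[of _ s]) (auto intro: ennreal_leI)
qed

lemma rearr_eq: "rearr u t = Inf {s. 0 \<le> s \<and> distribution u s \<le> ennreal t}"
  by (simp add: rearr_def distribution_def)

lemma less_rearr_iff:
  assumes u: "u \<in> L1" and t: "0 < t" and s: "0 \<le> s"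
  shows "s < rearr u t \<longleftrightarrow> ennreal t < distribution u s"
proof
  let ?S = "{s. 0 \<le> s \<and> distribution u s \<le> ennreal t}"
  have ne: "?S \<noteq> {}" using distribution_small[OF u t] by auto
  have bd: "bdd_below ?S" by (auto intro: bdd_belowI[of _ 0])
  note um = L1_measurable[OF u]
  show "ennreal t < distribution u s" if "s < rearr u t"
  proof (rule ccontr)
    assume "\<not> ennreal t < distribution u s"
    then have "Inf ?S \<le> s" using s by (intro cInf_lower bd) auto
    with that show False by (simp add: rearr_eq)
  qed
  show "s < rearr u t" if lt: "ennreal t < distribution u s"
  proof -
    obtain s' where s': "s' > s" "ennreal t < distribution u s'"
      using distribution_right_continuous[OF um lt] by blast
    have "s' \<le> Inf ?S"
    proof (rule cInf_greatest[OF ne])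
      fix r assume r: "r \<in> ?S"
      show "s' \<le> r"
      proof (rule ccontr)
        assume "\<not> s' \<le> r"
        then have "distribution u s' \<le> distribution u r"
          by (intro distribution_antimono um) auto
        with r s' show False by auto
      qed
    qed
    with s' show ?thesis by (simp add: rearr_eq)
  qed
qed

lemma rearr_nonneg:
  assumes "u \<in> L1" and "0 < t"
  shows "0 \<le> rearr u t"
  unfolding rearr_eq by (rule cInf_greatest) (use distribution_small[OF assms] in auto)

lemma superlevel_place:
  assumes u: "u \<in> L1" and a: "0 \<le> a" and s: "0 \<le> s"
  shows "{t \<in> space semiaxis. \<bar>place a u t\<bar> > s}
       = {t \<in> space semiaxis. a < t \<and> ennreal (t - a) < distribution u s}"
  using a s by (auto simp: place_def less_rearr_iff[OF u] rearr_nonneg[OF u] split: if_splits)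

lemma measurable_superlevelI:
  fixes u :: "real \<Rightarrow> real"
  assumes nn: "\<And>t. 0 < t \<Longrightarrow> 0 \<le> u t"
    and "\<And>s. 0 \<le> s \<Longrightarrow> {t \<in> space semiaxis. \<bar>u t\<bar> > s} \<in> sets semiaxis"
  shows "u \<in> borel_measurable semiaxis"
proof -
  have "{t \<in> space semiaxis. s < u t} \<in> sets semiaxis" for s
  proof (cases "0 \<le> s")
    case True
    have "{t \<in> space semiaxis. s < u t} = {t \<in> space semiaxis. \<bar>u t\<bar> > s}" using nn by auto
    then show ?thesis using assms(2)[OF True] by argo
  next
    case False
    then have "{t \<in> space semiaxis. s < u t} = space semiaxis"
      using nn by (auto intro: less_le_trans[of _ 0])
    then show ?thesis by (simp only: sets.top)
  qed
  then show ?thesis by (subst borel_measurable_iff_greater) blast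
qed

lemma place_nonneg: "u \<in> L1 \<Longrightarrow> 0 \<le> place a u t"
  by (auto simp: place_def rearr_nonneg)

lemma measurable_place:
  assumes u: "u \<in> L1" and a: "0 \<le> a"
  shows "place a u \<in> borel_measurable semiaxis"
  by (rule measurable_superlevelI[OF place_nonneg[OF u]])
    (simp_all only: superlevel_place[OF u a] sets_semiaxis_interval)

lemma distribution_place:
  assumes "u \<in> L1" and "0 \<le> a" and "0 \<le> s"
  shows "distribution (place a u) s = distribution u s"
  by (simp only: distribution_def[of "place a u"] superlevel_place[OF assms]
      emeasure_semiaxis_interval[OF assms(2)])

lemma equimeasurableI:
  assumes "\<And>s. 0 \<le> s \<Longrightarrow> distribution u s = distribution v s"
  shows "equimeasurable u v"
proof -
  have "{s. 0 \<le> s \<and> distribution u s \<le> ennreal t} = {s. 0 \<le> s \<and> distribution v s \<le> ennreal t}" for t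
    using assms by auto
  then show ?thesis by (simp add: equimeasurable_def rearr_eq)
qed

text \<open>
  The interval of all positive \<open>t\<close> below \<open>distribution u s\<close> is a superlevel set of \<open>rearr u\<close>, so the
  rearrangement determines the distribution function.
\<close>

lemma equimeasurableD:
  assumes "equimeasurable u v" "u \<in> L1" "v \<in> L1" "0 \<le> s"
  shows "distribution u s = distribution v s"
proof -
  have iff: "ennreal t < distribution u s \<longleftrightarrow> ennreal t < distribution v s" if "0 < t" for t
  proof -
    have "rearr u t = rearr v t"
      using assms(1) that unfolding equimeasurable_def by blast
    then show ?thesis
      using less_rearr_iff[OF assms(2) that assms(4)] less_rearr_iff[OF assms(3) that assms(4)]
      by (simp only:)
  qed
  have "{t \<in> space semiaxis. 0 < t \<and> ennreal (t - 0) < distribution u s}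
      = {t \<in> space semiaxis. 0 < t \<and> ennreal (t - 0) < distribution v s}"
    unfolding diff_0_right by (intro Collect_cong conj_cong refl iff)
  then show ?thesis
    using emeasure_semiaxis_interval[OF order_refl, of "distribution u s"]
      emeasure_semiaxis_interval[OF order_refl, of "distribution v s"] by argo
qed

section \<open>Integrals above a level\<close>

definition tail_integral :: "(real \<Rightarrow> real) \<Rightarrow> real \<Rightarrow> ennreal" where
  "tail_integral u s = (\<integral>\<^sup>+ t. ennreal (\<bar>u t\<bar> - s) \<partial>semiaxis)"

lemma sigma_finite_semiaxis: "sigma_finite_measure semiaxis"
proof (rule sigma_finite_measure_restrict_space)
  obtain C :: "real set set" where C: "countable C" "C \<subseteq> sets lborel" "(\<Union>C) = space lborel"
      "\<forall>a\<in>C. emeasure lborel a \<noteq> \<infinity>"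
    using lborel.sigma_finite_countable by blast
  have "emeasure lebesgue a \<noteq> \<infinity>" "a \<in> sets lebesgue" if "a \<in> C" for a
    using that C(2,4) by auto
  then show "sigma_finite_measure (lebesgue :: real measure)"
    using C(1,3) by (intro sigma_finite_measure.intro exI[of _ C]) auto
qed auto

text \<open>
  Tonelli's theorem applied to the region \<open>0 < r < |u t| - s\<close> expresses the integral through the
  distribution function alone, hence in a rearrangement invariant way.
\<close>

lemma tail_integral_layer_cake:
  assumes u: "u \<in> borel_measurable semiaxis"
  shows "tail_integral u s = (\<integral>\<^sup>+ r. distribution u (s + r) * indicator {0<..} r \<partial>lborel)"
proof -
  interpret pair_sigma_finite lborel semiaxis
    unfolding pair_sigma_finite_def
    using sigma_finite_semiaxis lborel.sigma_finite_measure_axioms by simp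
  have "tail_integral u s
      = (\<integral>\<^sup>+ t. \<integral>\<^sup>+ r. indicator {(r, t). 0 < r \<and> r < \<bar>u t\<bar> - s} (r, t) \<partial>lborel \<partial>semiaxis)"
    unfolding tail_integral_def
  proof (rule nn_integral_cong)
    fix t
    have "ennreal (\<bar>u t\<bar> - s) = emeasure lborel {0<..<\<bar>u t\<bar> - s}"
      by (cases "\<bar>u t\<bar> - s \<ge> 0") (auto simp: ennreal_neg)
    also have "\<dots> = (\<integral>\<^sup>+ r. indicator {0<..<\<bar>u t\<bar> - s} r \<partial>lborel)" by simp
    also have "\<dots> = (\<integral>\<^sup>+ r. indicator {(r, t). 0 < r \<and> r < \<bar>u t\<bar> - s} (r, t) \<partial>lborel)"
      by (rule nn_integral_cong) (auto simp: indicator_def)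
    finally show "ennreal (\<bar>u t\<bar> - s)
      = (\<integral>\<^sup>+ r. indicator {(r, t). 0 < r \<and> r < \<bar>u t\<bar> - s} (r, t) \<partial>lborel)" .
  qed
  also have "\<dots> = (\<integral>\<^sup>+ r. \<integral>\<^sup>+ t. indicator {(r, t). 0 < r \<and> r < \<bar>u t\<bar> - s} (r, t) \<partial>semiaxis \<partial>lborel)"
  proof (rule Fubini')
    have "Measurable.pred (lborel \<Otimes>\<^sub>M semiaxis) (\<lambda>(r, t). 0 < r \<and> r < \<bar>u t\<bar> - s)"
      using u by measurable
    then show "(\<lambda>(x, y). indicator {(r, t). 0 < r \<and> r < \<bar>u t\<bar> - s} (x, y)) \<in> borel_measurable (lborel \<Otimes>\<^sub>M semiaxis)"
      by (simp add: indicator_def split_beta')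
  qed
  also have "\<dots> = (\<integral>\<^sup>+ r. distribution u (s + r) * indicator {0<..} r \<partial>lborel)"
  proof (rule nn_integral_cong)
    fix r
    have "(\<integral>\<^sup>+ t. indicator {(r, t). 0 < r \<and> r < \<bar>u t\<bar> - s} (r, t) \<partial>semiaxis)
       = (\<integral>\<^sup>+ t. indicator {0<..} r * indicator {t \<in> space semiaxis. \<bar>u t\<bar> > s + r} t \<partial>semiaxis)"
      by (rule nn_integral_cong) (auto simp: indicator_def)
    also have "\<dots> = indicator {0<..} r * distribution u (s + r)"
      unfolding distribution_def by (rule nn_integral_cmult_indicator[OF sets_superlevel[OF u]])
    finally show "(\<integral>\<^sup>+ t. indicator {(r, t). 0 < r \<and> r < \<bar>u t\<bar> - s} (r, t) \<partial>semiaxis)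
       = distribution u (s + r) * indicator {0<..} r" by (simp add: mult.commute)
  qed
  finally show ?thesis .
qed

lemma tail_integral_mono:
  assumes "u \<in> borel_measurable semiaxis" "v \<in> borel_measurable semiaxis"
    and "\<And>r. s \<le> r \<Longrightarrow> distribution v r \<le> distribution u r"
  shows "tail_integral v s \<le> tail_integral u s"
  unfolding tail_integral_layer_cake[OF assms(1)] tail_integral_layer_cake[OF assms(2)]
  by (rule nn_integral_mono) (auto simp: indicator_def intro!: assms(3))

lemma L1_distribution_mono:
  assumes u: "u \<in> L1" and v: "v \<in> borel_measurable semiaxis"
    and le: "\<And>s. 0 \<le> s \<Longrightarrow> distribution v s \<le> distribution u s"
  shows "v \<in> L1"
proof -
  have "tail_integral v 0 \<le> tail_integral u 0"
    by (rule tail_integral_mono[OF L1_measurable[OF u] v le])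
  then show ?thesis
    using u L1_nn_integral[OF L1_measurable[OF u]] L1_nn_integral[OF v]
    by (simp add: tail_integral_def le_less_trans)
qed

lemma place_L1:
  assumes "u \<in> L1" and "0 \<le> a"
  shows "place a u \<in> L1"
  by (rule L1_distribution_mono[OF assms(1) measurable_place[OF assms]])
     (simp add: distribution_place[OF assms])

lemma L1_subset: "L1 \<subseteq> L1_plus_Linf"
proof
  fix u assume u: "u \<in> L1"
  have "(\<lambda>t. 0) \<in> Linf" by (auto simp: Linf_def)
  then show "u \<in> L1_plus_Linf"
    unfolding L1_plus_Linf_def using u L1_measurable[OF u]
    by (intro CollectI conjI bexI[of _ u] bexI[of _ "\<lambda>t. 0"]) auto
qed

section \<open>Symmetric spaces of integrable functions\<close>

locale symmetric_space_in_L1 =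
  fixes E :: "(real \<Rightarrow> real) set" and N :: "(real \<Rightarrow> real) \<Rightarrow> real"
  assumes symmetric: "symmetric_banach_space E N"
    and in_L1: "E \<subseteq> L1"
begin

lemma normed: "normed_function_space E N"
  using symmetric by (simp add: symmetric_banach_space_def banach_function_space_def)

lemma E_L1: "u \<in> E \<Longrightarrow> u \<in> L1"
  using in_L1 by blast

lemma E_measurable: "u \<in> E \<Longrightarrow> u \<in> borel_measurable semiaxis"
  by (rule L1_measurable[OF E_L1])

lemmas norm_axioms = normed[unfolded normed_function_space_def]

lemma E_zero: "(\<lambda>t. 0) \<in> E"
  using norm_axioms[THEN conjunct2, THEN conjunct1] by (simp only:)

lemma E_add: "u \<in> E \<Longrightarrow> v \<in> E \<Longrightarrow> (\<lambda>t. u t + v t) \<in> E"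
  using norm_axioms[THEN conjunct2, THEN conjunct2, THEN conjunct1] by blast

lemma E_scale: "u \<in> E \<Longrightarrow> (\<lambda>t. c * u t) \<in> E"
  using norm_axioms[THEN conjunct2, THEN conjunct2, THEN conjunct2, THEN conjunct1] by blast

lemma N_nonneg: "u \<in> E \<Longrightarrow> 0 \<le> N u"
  using norm_axioms[THEN conjunct2, THEN conjunct2, THEN conjunct2, THEN conjunct2, THEN conjunct2, THEN conjunct1] by blast

lemma N_eq_0_iff: "u \<in> E \<Longrightarrow> N u = 0 \<longleftrightarrow> (AE t in semiaxis. u t = 0)"
  using norm_axioms[THEN conjunct2, THEN conjunct2, THEN conjunct2, THEN conjunct2, THEN conjunct2, THEN conjunct2, THEN conjunct1] by blast

lemma N_scale: "u \<in> E \<Longrightarrow> N (\<lambda>t. c * u t) = \<bar>c\<bar> * N u"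
  using norm_axioms[THEN conjunct2, THEN conjunct2, THEN conjunct2, THEN conjunct2, THEN conjunct2, THEN conjunct2, THEN conjunct2, THEN conjunct1] by blast

lemma N_triangle: "u \<in> E \<Longrightarrow> v \<in> E \<Longrightarrow> N (\<lambda>t. u t + v t) \<le> N u + N v"
  using norm_axioms[THEN conjunct2, THEN conjunct2, THEN conjunct2, THEN conjunct2, THEN conjunct2, THEN conjunct2, THEN conjunct2, THEN conjunct2] by blast

lemma N_zero: "N (\<lambda>t. 0) = 0"
  using N_eq_0_iff[OF E_zero] by simp

lemma equimeasurable_norm:
  "u \<in> E \<Longrightarrow> v \<in> L1 \<Longrightarrow> equimeasurable v u \<Longrightarrow> v \<in> E \<and> N v = N u"
  using symmetric[unfolded symmetric_banach_space_def, THEN conjunct2, THEN conjunct2, THEN conjunct1]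
    L1_subset by blast

lemma order_ideal:
  "u \<in> E \<Longrightarrow> v \<in> borel_measurable semiaxis \<Longrightarrow> AE t in semiaxis. 0 \<le> v t \<and> v t \<le> u t \<Longrightarrow>
   v \<in> E \<and> N v \<le> N u"
  using symmetric[unfolded symmetric_banach_space_def, THEN conjunct2, THEN conjunct2, THEN conjunct2]
  by blast

text \<open>
  The order ideal property compares functions pointwise. Passing to rearrangements turns a comparison of
  distribution functions into a pointwise one.
\<close>

lemma distribution_dominated:
  assumes u: "u \<in> E" and v: "v \<in> borel_measurable semiaxis"
    and le: "\<And>s. 0 \<le> s \<Longrightarrow> distribution v s \<le> distribution u s"
  shows "v \<in> E \<and> N v \<le> N u"
proof -
  note uL = E_L1[OF u]
  have vL: "v \<in> L1" by (rule L1_distribution_mono[OF uL v le])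
  have "equimeasurable (place 0 u) u"
    by (rule equimeasurableI) (simp add: distribution_place[OF uL])
  then have pu: "place 0 u \<in> E" "N (place 0 u) = N u"
    using equimeasurable_norm[OF u place_L1[OF uL]] by auto
  have "place 0 v t \<le> place 0 u t" for t
  proof (rule ccontr)
    assume "\<not> place 0 v t \<le> place 0 u t"
    then have t: "0 < t" and lt: "rearr u t < rearr v t"
      by (auto simp: place_def split: if_splits)
    have r: "0 \<le> rearr u t" by (rule rearr_nonneg[OF uL t])
    have "ennreal t < distribution v (rearr u t)" using lt less_rearr_iff[OF vL t r] by simp
    also have "\<dots> \<le> distribution u (rearr u t)" by (rule le[OF r])
    finally show False using less_rearr_iff[OF uL t r] by simp
  qed
  then have pv: "place 0 v \<in> E" "N (place 0 v) \<le> N u"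
    using order_ideal[OF pu(1) measurable_place[OF vL]] place_nonneg[OF vL] pu(2) by auto
  have "equimeasurable v (place 0 v)"
    by (rule equimeasurableI) (simp add: distribution_place[OF vL])
  then show ?thesis using equimeasurable_norm[OF pv(1) vL] pv(2) by simp
qed

end

section \<open>Disjoint sums\<close>

text \<open>
  A rearrangement whose support has finite measure lives on a bounded interval, so that there is room
  for disjoint translates beyond it.
\<close>

definition finitely_supported :: "(real \<Rightarrow> real) \<Rightarrow> bool" where
  "finitely_supported u \<longleftrightarrow> u \<in> L1 \<and> distribution u 0 < \<infinity>"

lemma finitely_supported_L1: "finitely_supported u \<Longrightarrow> u \<in> L1"
  by (simp add: finitely_supported_def)

lemma L1_add: "u \<in> L1 \<Longrightarrow> v \<in> L1 \<Longrightarrow> (\<lambda>t. u t + v t) \<in> L1"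
  by (simp add: L1_def)

lemma L1_scale: "u \<in> L1 \<Longrightarrow> (\<lambda>t. c * u t) \<in> L1"
  by (simp add: L1_def)

lemma distribution_zero: "0 \<le> s \<Longrightarrow> distribution (\<lambda>t. 0) s = 0"
  by (simp add: distribution_def)

lemma distribution_scale:
  assumes "0 < c"
  shows "distribution (\<lambda>t. c * u t) s = distribution u (s / c)"
  using assms by (simp add: distribution_def abs_mult pos_divide_less_eq mult.commute)

lemma distribution_disjoint_add:
  assumes u: "u \<in> borel_measurable semiaxis" and v: "v \<in> borel_measurable semiaxis"
    and disj: "\<And>t. 0 < t \<Longrightarrow> u t = 0 \<or> v t = 0" and s: "0 \<le> s"
  shows "distribution (\<lambda>t. u t + v t) s = distribution u s + distribution v s"
proof -
  let ?L = "\<lambda>u. {t \<in> space semiaxis. \<bar>u t\<bar> > s}"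
  have "?L u \<inter> ?L v = {}" using disj s by force
  then have "distribution u s + distribution v s = emeasure semiaxis (?L u \<union> ?L v)"
    unfolding distribution_def by (intro plus_emeasure sets_superlevel u v)
  moreover have "?L u \<union> ?L v = ?L (\<lambda>t. u t + v t)" using disj s by force
  ultimately show ?thesis by (simp add: distribution_def)
qed

lemma place_eq_0:
  assumes u: "u \<in> L1" and A: "distribution u 0 \<le> ennreal A" and t: "t \<le> a \<or> a + A \<le> t"
  shows "place a u t = 0"
proof (rule ccontr)
  assume "place a u t \<noteq> 0"
  then have a: "a < t" and "rearr u (t - a) \<noteq> 0" by (auto simp: place_def split: if_splits)
  then have "0 < rearr u (t - a)" using rearr_nonneg[OF u, of "t - a"] by simp
  then have "ennreal (t - a) < distribution u 0"
    using less_rearr_iff[OF u, of "t - a" 0] a by simp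
  then have "ennreal (t - a) < ennreal A" using A by (rule less_le_trans)
  then have "t - a < A" by (metis ennreal_leI linorder_not_less)
  then show False using a t by simp
qed

lemma finitely_supported_bound:
  assumes "finitely_supported u" "finitely_supported v"
  obtains A where "0 \<le> A" "distribution u 0 \<le> ennreal A" "distribution v 0 \<le> ennreal A"
proof -
  obtain a where a: "distribution u 0 = ennreal a" "0 \<le> a"
    using assms(1) by (cases "distribution u 0") (auto simp: finitely_supported_def)
  obtain b where b: "distribution v 0 = ennreal b" "0 \<le> b"
    using assms(2) by (cases "distribution v 0") (auto simp: finitely_supported_def)
  show ?thesis
    by (rule that[of "max a b"]) (use a b in \<open>auto intro!: ennreal_leI simp: max_def\<close>)
qed

definition truncate_above :: "real \<Rightarrow> (real \<Rightarrow> real) \<Rightarrow> real \<Rightarrow> real" where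
  "truncate_above S u t = (if \<bar>u t\<bar> > S then u t else 0)"

lemma truncate_above_L1:
  assumes "u \<in> L1"
  shows "truncate_above S u \<in> L1"
proof -
  have "truncate_above S u = (\<lambda>t. if \<bar>u t\<bar> > S then u t else 0)" by (auto simp: truncate_above_def)
  moreover have "(\<lambda>t. if \<bar>u t\<bar> > S then u t else 0) \<in> borel_measurable semiaxis"
    using L1_measurable[OF assms] by measurable
  ultimately have m: "truncate_above S u \<in> borel_measurable semiaxis" by simp
  show ?thesis
    by (rule L1_distribution_mono[OF assms m])
      (auto simp: distribution_def truncate_above_def intro!: emeasure_mono sets_superlevel[OF L1_measurable[OF assms], simplified])
qed

lemma distribution_truncate_above:
  "0 \<le> s \<Longrightarrow> distribution (truncate_above S u) s = distribution u (max s S)"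
  unfolding distribution_def by (rule arg_cong[where f = "emeasure semiaxis"]) (auto simp: truncate_above_def)

lemma truncate_above_finitely_supported:
  assumes "u \<in> L1" "0 < S"
  shows "finitely_supported (truncate_above S u)"
  using truncate_above_L1[OF assms(1)] distribution_finite[OF assms] assms(2)
  by (simp add: finitely_supported_def distribution_truncate_above)

context symmetric_space_in_L1
begin

lemma place_in_E:
  assumes "u \<in> E" and "0 \<le> a"
  shows "place a u \<in> E" and "N (place a u) = N u"
proof -
  have "equimeasurable (place a u) u"
    by (rule equimeasurableI) (simp add: distribution_place[OF E_L1[OF assms(1)] assms(2)])
  then show "place a u \<in> E" and "N (place a u) = N u"
    using equimeasurable_norm[OF assms(1) place_L1[OF E_L1[OF assms(1)] assms(2)]] by auto
qed

text \<open>
  The norm bound is attached as an implication because disjoint sums are also needed for functions that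
  are not known to lie in \<open>E\<close>; there only the distribution function of the sum is of interest.
\<close>

lemma disjoint_sum2:
  assumes u: "finitely_supported u" and v: "finitely_supported v"
  shows "\<exists>w. finitely_supported w \<and> (\<forall>s\<ge>0. distribution w s = distribution u s + distribution v s) \<and>
    (u \<in> E \<and> v \<in> E \<longrightarrow> w \<in> E \<and> N w \<le> N u + N v)"
proof -
  note uL = finitely_supported_L1[OF u] and vL = finitely_supported_L1[OF v]
  obtain A where A: "0 \<le> A" "distribution u 0 \<le> ennreal A"
    using finitely_supported_bound[OF u u] by blast
  define w where "w = (\<lambda>t. place 0 u t + place A v t)"
  have d: "distribution w s = distribution u s + distribution v s" if "0 \<le> s" for s
  proof -
    have "place 0 u t = 0 \<or> place A v t = 0" for t
      using place_eq_0[OF uL A(2), of t 0] by (cases "A \<le> t") (auto simp: place_def[of A])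
    then show ?thesis
      unfolding w_def using distribution_disjoint_add[OF measurable_place[OF uL order_refl] measurable_place[OF vL A(1)] _ that]
      by (simp add: distribution_place[OF uL order_refl that] distribution_place[OF vL A(1) that])
  qed
  have "w \<in> L1" unfolding w_def by (intro L1_add place_L1 uL vL A(1) order_refl)
  then have "finitely_supported w"
    using d[of 0] u v by (simp add: finitely_supported_def)
  moreover have "w \<in> E \<and> N w \<le> N u + N v" if "u \<in> E" "v \<in> E"
    unfolding w_def using E_add[OF place_in_E(1)[OF that(1) order_refl] place_in_E(1)[OF that(2) A(1)]]
      N_triangle[OF place_in_E(1)[OF that(1) order_refl] place_in_E(1)[OF that(2) A(1)]]
      place_in_E(2)[OF that(1) order_refl] place_in_E(2)[OF that(2) A(1)] by simp
  ultimately show ?thesis using d by blast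
qed

lemma disjoint_sum:
  assumes "finite I" and "\<And>i. i \<in> I \<Longrightarrow> finitely_supported (u i)"
  shows "\<exists>w. finitely_supported w \<and> (\<forall>s\<ge>0. distribution w s = (\<Sum>i\<in>I. distribution (u i) s)) \<and>
    ((\<forall>i\<in>I. u i \<in> E) \<longrightarrow> w \<in> E \<and> N w \<le> (\<Sum>i\<in>I. N (u i)))"
  using assms
proof (induction I)
  case empty
  have "finitely_supported (\<lambda>t. 0)"
    by (simp add: finitely_supported_def distribution_zero L1_def)
  then show ?case
    by (intro exI[of _ "\<lambda>t. 0"]) (simp add: distribution_zero E_zero N_zero)
next
  case (insert j I)
  then obtain w where w: "finitely_supported w" "\<forall>s\<ge>0. distribution w s = (\<Sum>i\<in>I. distribution (u i) s)"
    "(\<forall>i\<in>I. u i \<in> E) \<longrightarrow> w \<in> E \<and> N w \<le> (\<Sum>i\<in>I. N (u i))"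
    by auto
  have "finitely_supported (u j)" using insert.prems by simp
  then obtain w' where w': "finitely_supported w'"
    "\<forall>s\<ge>0. distribution w' s = distribution (u j) s + distribution w s"
    "u j \<in> E \<and> w \<in> E \<longrightarrow> w' \<in> E \<and> N w' \<le> N (u j) + N w"
    using disjoint_sum2[of "u j" w] w(1) by blast
  show ?case
  proof (intro exI[of _ w'] conjI allI impI)
    show "finitely_supported w'" by fact
    show "distribution w' s = (\<Sum>i\<in>insert j I. distribution (u i) s)" if "0 \<le> s" for s
      using that w(2) w'(2) insert.hyps by simp
    assume a: "\<forall>i\<in>insert j I. u i \<in> E"
    then show "w' \<in> E" using w(3) w'(3) by simp
    have "N w' \<le> N (u j) + N w" "N w \<le> (\<Sum>i\<in>I. N (u i))" using a w(3) w'(3) by simp_all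
    then show "N w' \<le> (\<Sum>i\<in>insert j I. N (u i))" using insert.hyps by simp
  qed
qed

lemma copies:
  assumes "finitely_supported u"
  shows "\<exists>w. finitely_supported w \<and> (\<forall>s\<ge>0. distribution w s = of_nat k * distribution u s) \<and>
    (u \<in> E \<longrightarrow> w \<in> E \<and> N w \<le> real k * N u)"
  using disjoint_sum[of "{..<k}" "\<lambda>_. u"] assms by auto

section \<open>Averaging over disjoint copies\<close>

text \<open>
  For \<open>c < k\<close> let \<open>W\<^sub>c\<close> consist of \<open>v\<close> at a fixed place and of \<open>u\<close> in the \<open>c\<close>-th of \<open>k\<close> disjoint slots. All
  \<open>W\<^sub>c\<close> have the distribution function of the disjoint sum of \<open>u\<close> and \<open>v\<close>, hence norm at most that of
  \<open>V\<close>, and so has their mean. The mean keeps \<open>v\<close> and spreads \<open>u\<close> over \<open>k\<close> copies of \<open>u / k\<close>.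
\<close>

lemma averaging:
  assumes V: "V \<in> E" and u: "finitely_supported u" and v: "finitely_supported v"
    and le: "\<And>s. 0 \<le> s \<Longrightarrow> distribution u s + distribution v s \<le> distribution V s"
    and k: "0 < k"
  shows "\<exists>U\<in>E. N U \<le> N V \<and>
    (\<forall>s\<ge>0. distribution U s = of_nat k * distribution u (real k * s) + distribution v s)"
proof -
  note uL = finitely_supported_L1[OF u] and vL = finitely_supported_L1[OF v]
  obtain A where A: "0 \<le> A" "distribution u 0 \<le> ennreal A" "distribution v 0 \<le> ennreal A"
    using finitely_supported_bound[OF u v] by blast
  \<comment> \<open>The slot of \<open>v\<close> is the interval up to \<open>A\<close>; slot \<open>c\<close> of \<open>u\<close> has length \<open>A\<close> and follows the earlier ones.\<close>
  define p where "p c = place (A + real c * A) u" for c :: nat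
  have pos: "0 \<le> A + real c * A" for c :: nat using A(1) by simp
  note pm = measurable_place[OF uL pos, folded p_def] and vm = measurable_place[OF vL order_refl]
  have p0: "p c t = 0" if "t \<le> A + real c * A \<or> A + real (Suc c) * A \<le> t" for c t
    unfolding p_def by (rule place_eq_0[OF uL A(2)]) (use that in \<open>auto simp: algebra_simps\<close>)
  have v0: "place 0 v t = 0" if "A \<le> t" for t
    by (rule place_eq_0[OF vL A(3)]) (use that in auto)
  define W where "W c t = place 0 v t + p c t" for c t
  have W: "W c \<in> E" "N (W c) \<le> N V" for c
  proof -
    have "distribution (\<lambda>t. place 0 v t + p c t) s = distribution v s + distribution u s" if "0 \<le> s" for s
    proof -
      have "place 0 v t = 0 \<or> p c t = 0" for t
      proof (cases "A \<le> t")
        case False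
        then have "t \<le> A + real c * A" using A(1) by (simp add: add_increasing2)
        then show ?thesis using p0 by simp
      qed (use v0 in simp)
      then have "distribution (\<lambda>t. place 0 v t + p c t) s = distribution (place 0 v) s + distribution (p c) s"
        using distribution_disjoint_add[OF vm pm _ that] by simp
      then show ?thesis
        by (simp add: p_def distribution_place[OF vL order_refl that] distribution_place[OF uL pos that])
    qed
    then have "W c \<in> E \<and> N (W c) \<le> N V"
      by (intro distribution_dominated[OF V])
        (auto simp: W_def[abs_def] le add.commute intro: borel_measurable_add vm pm)
    then show "W c \<in> E" "N (W c) \<le> N V" by auto
  qed
  have sumW: "(\<lambda>t. \<Sum>c<j. W c t) \<in> E \<and> N (\<lambda>t. \<Sum>c<j. W c t) \<le> real j * N V" for j
  proof (induction j)
    case 0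
    show ?case by (simp add: E_zero N_zero)
  next
    case (Suc j)
    then show ?case
      using E_add[of "\<lambda>t. \<Sum>c<j. W c t" "W j"] N_triangle[of "\<lambda>t. \<Sum>c<j. W c t" "W j"] W[of j]
      by (simp add: algebra_simps)
  qed
  define U where "U t = place 0 v t + (\<Sum>c<k. 1 / real k * p c t)" for t
  \<comment> \<open>Each \<open>W c\<close> contains \<open>v\<close> at the same place, so the mean retains it with coefficient one.\<close>
  have U_eq: "U = (\<lambda>t. 1 / real k * (\<Sum>c<k. W c t))"
    using k by (auto simp: U_def W_def sum.distrib sum_distrib_left field_simps)
  have "U \<in> E" unfolding U_eq using sumW E_scale by blast
  moreover have "N U \<le> N V"
  proof -
    have "N U = 1 / real k * N (\<lambda>t. \<Sum>c<k. W c t)"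
      unfolding U_eq using N_scale[of "\<lambda>t. \<Sum>c<k. W c t" "1 / real k"] sumW[of k] by simp
    also have "\<dots> \<le> 1 / real k * (real k * N V)"
      by (intro mult_left_mono) (use sumW[of k] in auto)
    finally show ?thesis using k by simp
  qed
  moreover have "distribution U s = of_nat k * distribution u (real k * s) + distribution v s"
    if s: "0 \<le> s" for s
  proof -
    define T where "T j = (\<lambda>t. place 0 v t + (\<Sum>c<j. 1 / real k * p c t))" for j
    have Tm: "T j \<in> borel_measurable semiaxis" for j
      unfolding T_def by (intro borel_measurable_add vm borel_measurable_sum borel_measurable_times borel_measurable_const pm)
    have "distribution (T j) s = of_nat j * distribution u (real k * s) + distribution v s" for j
    proof (induction j)
      case 0
      show ?case by (simp add: T_def distribution_place[OF vL order_refl s])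
    next
      case (Suc j)
      have T0: "T j t = 0" if "A + real j * A \<le> t" for t
      proof -
        have "p c t = 0" if "c < j" for c
        proof -
          have "real (Suc c) * A \<le> real j * A" using that A(1) by (intro mult_right_mono) auto
          then show ?thesis using p0[where c = c and t = t] \<open>A + real j * A \<le> t\<close> by linarith
        qed
        moreover have "A \<le> t" using that pos[of j] A(1) by (smt (verit) mult_nonneg_nonneg of_nat_0_le_iff)
        ultimately show ?thesis using v0 by (simp add: T_def)
      qed
      have "T j t = 0 \<or> 1 / real k * p j t = 0" for t
        using T0[of t] p0[where c = j and t = t] by (cases "A + real j * A \<le> t") auto
      then have "distribution (\<lambda>t. T j t + 1 / real k * p j t) s
          = distribution (T j) s + distribution (\<lambda>t. 1 / real k * p j t) s"
        by (intro distribution_disjoint_add Tm borel_measurable_times borel_measurable_const pm s)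
      also have "distribution (\<lambda>t. 1 / real k * p j t) s = distribution u (real k * s)"
      proof -
        have "distribution (p j) (real k * s) = distribution u (real k * s)"
          unfolding p_def by (rule distribution_place[OF uL pos]) (use s in simp)
        then show ?thesis
          using distribution_scale[of "1 / real k" "p j" s] k by (simp add: mult.commute)
      qed
      also have "(\<lambda>t. T j t + 1 / real k * p j t) = T (Suc j)" by (simp add: T_def add.assoc)
      finally show ?case by (simp add: Suc.IH algebra_simps)
    qed
    moreover have "T k = U" by (auto simp: T_def U_def)
    ultimately show ?thesis by metis
  qed
  ultimately show ?thesis by blast
qed

text \<open>
  The summands of index at most \<open>j\<close> are merged into \<open>j + 1\<close> equal ones of index \<open>j\<close>, for increasing \<open>j\<close>:
  averaging the merged part over \<open>q\<close> copies raises its index from \<open>j\<close> to \<open>j + 1\<close>, where it meets one more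
  summand. The truncation at \<open>S\<close> survives because averaging can only lower the truncation level.
\<close>

lemma flattening:
  fixes q r :: nat
  assumes x: "x \<in> L1" and q: "0 < q" and S: "0 < S" and V: "V \<in> E"
    and le: "\<And>s. 0 \<le> s \<Longrightarrow>
      (\<Sum>i\<le>r. of_nat (q ^ i) * distribution x (real (q ^ i) * max s S)) \<le> distribution V s"
  shows "\<exists>U\<in>E. N U \<le> N V \<and>
    (\<forall>s\<ge>0. of_nat (Suc r * q ^ r) * distribution x (real (q ^ r) * max s S) \<le> distribution U s)"
proof -
  let ?d = "\<lambda>i s. distribution x (real (q ^ i) * max s S)"
  have qi: "0 < real (q ^ i)" for i using q by simp
  have ex: "\<exists>w. finitely_supported w \<and> (\<forall>s\<ge>0. distribution w s = of_nat n * ?d i s)" for n i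
  proof -
    let ?t = "truncate_above S (\<lambda>t. 1 / real (q ^ i) * x t)"
    have d: "distribution ?t s = ?d i s" if "0 \<le> s" for s
      using distribution_scale[of "1 / real (q ^ i)" x "max s S"] qi[of i] that
      by (simp add: distribution_truncate_above mult.commute)
    have "finitely_supported ?t"
      by (rule truncate_above_finitely_supported[OF L1_scale[OF x] S])
    then obtain w where "finitely_supported w" "\<forall>s\<ge>0. distribution w s = of_nat n * distribution ?t s"
      using copies[of ?t n] by blast
    then show ?thesis using d by (intro exI[of _ w]) simp
  qed
  have "\<exists>U\<in>E. N U \<le> N V \<and> (\<forall>s\<ge>0. of_nat (Suc j * q ^ j) * ?d j s
      + (\<Sum>i\<in>{j<..r}. of_nat (q ^ i) * ?d i s) \<le> distribution U s)" if "j \<le> r" for j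
    using that
  proof (induction j)
    case 0
    have "{..r} = insert 0 {0<..r}" by auto
    then have "(\<Sum>i\<le>r. of_nat (q ^ i) * ?d i s) = ?d 0 s + (\<Sum>i\<in>{0<..r}. of_nat (q ^ i) * ?d i s)" for s
      by (simp)
    then show ?case using V le by (intro bexI[of _ V]) auto
  next
    case (Suc j)
    then obtain U where U: "U \<in> E" "N U \<le> N V" "\<forall>s\<ge>0. of_nat (Suc j * q ^ j) * ?d j s
      + (\<Sum>i\<in>{j<..r}. of_nat (q ^ i) * ?d i s) \<le> distribution U s" by auto
    obtain u where u: "finitely_supported u" "\<forall>s\<ge>0. distribution u s = of_nat (Suc j * q ^ j) * ?d j s"
      using ex by blast
    have "\<exists>w. \<forall>i. finitely_supported (w i) \<and> (\<forall>s\<ge>0. distribution (w i) s = of_nat (q ^ i) * ?d i s)"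
      by (intro choice allI ex)
    then obtain w where w: "\<And>i. finitely_supported (w i)"
        "\<And>i s. 0 \<le> s \<Longrightarrow> distribution (w i) s = of_nat (q ^ i) * ?d i s" by blast
    obtain v where v: "finitely_supported v" "\<forall>s\<ge>0. distribution v s = (\<Sum>i\<in>{j<..r}. distribution (w i) s)"
      using disjoint_sum[of "{j<..r}" w] w(1) by auto
    obtain U' where U': "U' \<in> E" "N U' \<le> N U"
      "\<forall>s\<ge>0. distribution U' s = of_nat q * distribution u (real q * s) + distribution v s"
      using averaging[OF U(1) u(1) v(1) _ q] U(3) u(2) v(2) w(2) by auto
    show ?case
    proof (intro bexI[of _ U'] conjI allI impI)
      show "U' \<in> E" "N U' \<le> N V" using U' U(2) by auto
      fix s :: real assume s: "0 \<le> s"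
      have I: "{j<..r} = insert (Suc j) {Suc j<..r}" using Suc.prems by auto
      \<comment> \<open>After averaging, the merged part is truncated at \<open>S / q\<close> instead of \<open>S\<close>, which only enlarges it.\<close>
      have "?d (Suc j) s \<le> ?d j (real q * s)"
      proof (rule distribution_antimono[OF L1_measurable[OF x]])
        have "max (real q * s) S \<le> real q * max s S"
        proof (rule max.boundedI)
          show "real q * s \<le> real q * max s S" by (intro mult_left_mono) auto
          have "1 * max s S \<le> real q * max s S" by (intro mult_right_mono) (use q S in auto)
          then show "S \<le> real q * max s S" by simp
        qed
        then have "real (q ^ j) * max (real q * s) S \<le> real (q ^ j) * (real q * max s S)"
          by (rule mult_left_mono) simp
        also have "\<dots> = real (q ^ Suc j) * max s S" by simp
        finally show "real (q ^ j) * max (real q * s) S \<le> real (q ^ Suc j) * max s S" .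
      qed
      then have "of_nat (Suc j * q ^ Suc j) * ?d (Suc j) s
          \<le> of_nat q * distribution u (real q * s)"
        using u(2) s q by (simp add: mult.assoc mult.left_commute mult_left_mono del: of_nat_Suc)
      moreover have "distribution v s = of_nat (q ^ Suc j) * ?d (Suc j) s
          + (\<Sum>i\<in>{Suc j<..r}. of_nat (q ^ i) * ?d i s)"
        using v(2) w(2) s unfolding I by simp
      ultimately have "of_nat (Suc j * q ^ Suc j) * ?d (Suc j) s + (of_nat (q ^ Suc j) * ?d (Suc j) s
          + (\<Sum>i\<in>{Suc j<..r}. of_nat (q ^ i) * ?d i s)) \<le> distribution U' s"
        using U'(3) s by (simp add: add_mono)
      moreover have "of_nat (Suc (Suc j) * q ^ Suc j) * ?d (Suc j) s
          = of_nat (Suc j * q ^ Suc j) * ?d (Suc j) s + of_nat (q ^ Suc j) * ?d (Suc j) s"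
        by (simp only: mult_Suc of_nat_add distrib_right add.commute)
      ultimately show "of_nat (Suc (Suc j) * q ^ Suc j) * ?d (Suc j) s
          + (\<Sum>i\<in>{Suc j<..r}. of_nat (q ^ i) * ?d i s) \<le> distribution U' s"
        by (simp only: add.assoc)
    qed
  qed
  from this[of r] show ?thesis by simp
qed

end

section \<open>Existence of the limit\<close>

text \<open>
  A variant of Fekete's lemma. For fixed \<open>m\<close> the hypothesis with \<open>k = n div m + 1\<close> gives
  \<open>a n / n \<le> a m / m + a m / n\<close>, so the ratios converge to their infimum.
\<close>

lemma subadditive_ratio_limit:
  fixes a :: "nat \<Rightarrow> real"
  assumes nonneg: "\<And>n. 0 < n \<Longrightarrow> 0 \<le> a n"
    and sub: "\<And>n m k. 0 < n \<Longrightarrow> 0 < m \<Longrightarrow> n \<le> k * m \<Longrightarrow> a n \<le> real k * a m"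
  shows "\<exists>L\<ge>0. (\<lambda>n. 1 / real n * a n) \<longlonglongrightarrow> L \<and> (\<forall>m>0. L \<le> a m / real m)"
proof -
  define A where "A = {a m / real m |m. 0 < m}"
  have ne: "A \<noteq> {}" unfolding A_def by blast
  have nn: "0 \<le> y" if "y \<in> A" for y using that nonneg by (auto simp: A_def)
  then have bd: "bdd_below A" by (auto intro: bdd_belowI[of _ 0])
  have lower: "Inf A \<le> a m / real m" if "0 < m" for m
    by (rule cInf_lower[OF _ bd]) (use that in \<open>auto simp: A_def\<close>)
  have "(\<lambda>n. 1 / real n * a n) \<longlonglongrightarrow> Inf A"
  proof (rule LIMSEQ_I)
    fix e :: real assume e: "0 < e"
    have "\<exists>y\<in>A. y < Inf A + e / 2" using cInf_lessD[OF ne, of "Inf A + e / 2"] e by auto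
    then obtain m where m: "0 < m" "a m / real m < Inf A + e / 2" by (auto simp: A_def)
    \<comment> \<open>The remainder \<open>a m / n\<close> is below \<open>e / 2\<close> from \<open>n0\<close> on.\<close>
    obtain n0 :: nat where n0: "2 * a m / e < real n0" using reals_Archimedean2 by blast
    show "\<exists>no. \<forall>n\<ge>no. norm (1 / real n * a n - Inf A) < e"
    proof (intro exI[of _ "max n0 1"] allI impI)
      fix n assume n: "max n0 1 \<le> n"
      then have n1: "0 < real n" "real n0 \<le> real n" "0 < n" by auto
      have "n \<le> (n div m + 1) * m"
        using dividend_less_div_times[OF m(1), of n] by simp
      then have "a n \<le> real (n div m + 1) * a m"
        using sub[OF n1(3) m(1)] by blast
      also have "\<dots> \<le> (real n / real m + 1) * a m"
      proof (rule mult_right_mono)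
        show "real (n div m + 1) \<le> real n / real m + 1" using of_nat_div_le_of_nat[of n m, where ?'a = real] by simp
      qed (use nonneg m in auto)
      also have "\<dots> = real n * (a m / real m + a m / real n)"
        using m n1 by (simp add: field_simps)
      finally have "1 / real n * a n \<le> a m / real m + a m / real n"
        using n1 by (simp add: pos_divide_le_eq mult.commute)
      moreover have "a m / real n < e / 2"
      proof -
        have "2 * a m / e < real n" using n0 n1 by linarith
        then show ?thesis using e n1 by (simp add: field_simps)
      qed
      moreover have "Inf A \<le> 1 / real n * a n" using lower[OF n1(3)] by simp
      ultimately show "norm (1 / real n * a n - Inf A) < e"
        unfolding real_norm_def using m(2) by linarith
    qed
  qed
  moreover have "0 \<le> Inf A" by (rule cInf_greatest[OF ne nn])
  ultimately show ?thesis using lower by blast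
qed

definition dilated_rearr :: "(real \<Rightarrow> real) \<Rightarrow> nat \<Rightarrow> real \<Rightarrow> real" where
  "dilated_rearr x m = (\<lambda>t. dilation (real m) (rearr x) t * indicator {0<..<1} t)"

lemma ennreal_less_mult_iff:
  assumes "0 < m" "0 < t"
  shows "ennreal (t / real m) < d \<longleftrightarrow> ennreal t < of_nat m * d"
proof (cases d)
  case (real r)
  then show ?thesis using assms
    by (simp add: ennreal_less_iff ennreal_of_nat_eq_real_of_nat ennreal_mult[symmetric] field_simps)
next
  case top
  then show ?thesis using assms by (simp add: ennreal_mult_top)
qed

lemma superlevel_dilated_rearr:
  assumes x: "x \<in> L1" and m: "0 < m" and s: "0 \<le> s"
  shows "{t \<in> space semiaxis. \<bar>dilated_rearr x m t\<bar> > s}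
    = {t \<in> space semiaxis. 0 < t \<and> ennreal (t - 0) < min 1 (of_nat m * distribution x s)}"
proof (rule Collect_cong, rule conj_cong[OF refl])
  fix t assume "t \<in> space semiaxis"
  then have t: "0 < t" and tm: "0 < t / real m" using m by auto
  have "\<bar>dilated_rearr x m t\<bar> > s \<longleftrightarrow> t < 1 \<and> s < rearr x (t / real m)"
    using s t rearr_nonneg[OF x tm] by (auto simp: dilated_rearr_def dilation_def indicator_def)
  also have "\<dots> \<longleftrightarrow> ennreal t < 1 \<and> ennreal t < of_nat m * distribution x s"
    using less_rearr_iff[OF x tm s] ennreal_less_mult_iff[OF m t] t
    by (simp add: ennreal_less_one_iff)
  finally show "s < \<bar>dilated_rearr x m t\<bar> \<longleftrightarrow> 0 < t \<and> ennreal (t - 0) < min 1 (of_nat m * distribution x s)"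
    using t by simp
qed

lemma distribution_dilated_rearr:
  assumes "x \<in> L1" "0 < m" "0 \<le> s"
  shows "distribution (dilated_rearr x m) s = min 1 (of_nat m * distribution x s)"
  by (simp only: distribution_def[of "dilated_rearr x m"] superlevel_dilated_rearr[OF assms]
      emeasure_semiaxis_interval[OF order_refl])

lemma dilated_rearr_nonneg:
  assumes "x \<in> L1" "0 < m" "0 < t"
  shows "0 \<le> dilated_rearr x m t"
  using rearr_nonneg[OF assms(1), of "t / real m"] assms by (simp add: dilated_rearr_def dilation_def)

lemma measurable_dilated_rearr:
  assumes "x \<in> L1" "0 < m"
  shows "dilated_rearr x m \<in> borel_measurable semiaxis"
  by (rule measurable_superlevelI[OF dilated_rearr_nonneg[OF assms]])
    (simp_all only: superlevel_dilated_rearr[OF assms] sets_semiaxis_interval)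

context symmetric_space_in_L1
begin

text \<open>
  With \<open>d\<close> the distribution function of \<open>x\<close>, the dilation by \<open>n\<close>, cut off to the unit interval, has the
  distribution function \<open>min 1 (n d)\<close>. For \<open>0 < n \<le> k m\<close> this is at most \<open>k min 1 (m d)\<close>, which belongs
  to \<open>k\<close> disjoint copies of the dilation by \<open>m\<close>.
\<close>

lemma dilated_rearr_subhomogeneous:
  assumes x: "x \<in> E" and m: "0 < m"
  shows "dilated_rearr x m \<in> E"
    and "0 < n \<Longrightarrow> n \<le> k * m \<Longrightarrow> N (dilated_rearr x n) \<le> real k * N (dilated_rearr x m)"
proof -
  note xL = E_L1[OF x]
  have dominated: "dilated_rearr x n \<in> E \<and> N (dilated_rearr x n) \<le> real k * N (dilated_rearr x l)"
    if g: "dilated_rearr x l \<in> E" and l: "0 < l" and n: "0 < n" "n \<le> k * l" for n k l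
  proof -
    let ?g = "dilated_rearr x l"
    have "finitely_supported ?g"
      unfolding finitely_supported_def using E_L1[OF g]
      by (simp add: distribution_dilated_rearr[OF xL l] min.strict_coboundedI1)
    then obtain w where w: "w \<in> E" "N w \<le> real k * N ?g" "\<And>s. 0 \<le> s \<Longrightarrow> distribution w s = of_nat k * distribution ?g s"
      using copies[of ?g k] g by auto
    have "distribution (dilated_rearr x n) s \<le> distribution w s" if s: "0 \<le> s" for s
    proof -
      let ?d = "distribution x s"
      have "k \<noteq> 0" using n by (intro notI) simp
      then have "(1::ennreal) \<le> of_nat k" by (metis One_nat_def Suc_leI neq0_conv of_nat_1 of_nat_mono)
      moreover have "of_nat n * ?d \<le> of_nat k * (of_nat l * ?d)"
        using n(2) unfolding mult.assoc[symmetric] of_nat_mult[symmetric]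
        by (intro mult_right_mono of_nat_mono) auto
      ultimately have "min 1 (of_nat n * ?d) \<le> of_nat k * min 1 (of_nat l * ?d)"
        by (cases "1 \<le> of_nat l * ?d") (auto simp: min.absorb1 min.absorb2 intro: min.coboundedI1 min.coboundedI2)
      then show ?thesis
        by (simp add: w(3)[OF s] distribution_dilated_rearr[OF xL _ s] n(1) l)
    qed
    then have "dilated_rearr x n \<in> E \<and> N (dilated_rearr x n) \<le> N w"
      by (rule distribution_dominated[OF w(1) measurable_dilated_rearr[OF xL n(1)]])
    then show ?thesis using w(2) by simp
  qed
  have "dilated_rearr x 1 \<in> E"
    using distribution_dominated[OF x measurable_dilated_rearr[OF xL, of 1]]
    by (simp add: distribution_dilated_rearr[OF xL])
  then have in_E: "dilated_rearr x m \<in> E" if "0 < m" for m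
    using dominated[of 1 m m] that by simp
  show "dilated_rearr x m \<in> E" by (rule in_E[OF m])
  show "N (dilated_rearr x n) \<le> real k * N (dilated_rearr x m)" if "0 < n" "n \<le> k * m"
    using dominated[OF in_E[OF m] m that] by simp
qed

lemma dilated_rearr_limit:
  assumes x: "x \<in> E"
  shows "\<exists>L\<ge>0. (\<lambda>m. 1 / real m * N (dilated_rearr x m)) \<longlonglongrightarrow> L \<and>
    (\<forall>m>0. L \<le> N (dilated_rearr x m) / real m)"
  using dilated_rearr_subhomogeneous[OF x]
  by (intro subadditive_ratio_limit N_nonneg) auto

lemma truncate_above_in_E:
  assumes "u \<in> E"
  shows "truncate_above S u \<in> E"
  using distribution_dominated[OF assms L1_measurable[OF truncate_above_L1[OF E_L1[OF assms]]]]
    distribution_antimono[OF E_measurable[OF assms]] by (simp add: distribution_truncate_above)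

text \<open>
  Some superlevel set of a nonzero \<open>x\<close> has positive measure; finitely many disjoint copies of it cover a
  set of measure one.
\<close>

lemma unit_indicator_in_E:
  assumes x: "x \<in> E" and nz: "\<not> (AE t in semiaxis. x t = 0)"
  shows "indicator {0<..<1} \<in> E"
proof -
  note xL = E_L1[OF x]
  let ?\<chi> = "indicator {0<..<1} :: real \<Rightarrow> real"
  have "{t \<in> space semiaxis. x t \<noteq> 0} = {t \<in> space semiaxis. \<bar>x t\<bar> > 0}" by auto
  then have "distribution x 0 \<noteq> 0"
    using nz AE_iff_measurable[OF sets_superlevel[OF E_measurable[OF x], of 0], of "\<lambda>t. x t = 0"]
    by (auto simp: distribution_def)
  then obtain c where c: "0 < c" "0 < distribution x c"
    using distribution_right_continuous[OF E_measurable[OF x], of 0 0] by (auto simp: zero_less_iff_neq_zero)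
  obtain d where d: "distribution x c = ennreal d" "0 < d"
    using distribution_finite[OF xL c(1)] c(2) by (cases "distribution x c") auto
  \<comment> \<open>So many copies of a set of measure \<open>d\<close> have total measure at least one.\<close>
  obtain k :: nat where k: "1 / d < real k" using reals_Archimedean2 by blast
  let ?y = "truncate_above 1 (\<lambda>t. 1 / c * x t)"
  have yL: "(\<lambda>t. 1 / c * x t) \<in> E" by (rule E_scale[OF x])
  have dy: "distribution ?y s = distribution x (c * max s 1)" if "0 \<le> s" for s
    using that c(1) distribution_scale[of "1 / c" x "max s 1"]
    by (simp add: distribution_truncate_above mult.commute)
  have y: "finitely_supported ?y" by (rule truncate_above_finitely_supported[OF E_L1[OF yL]]) simp
  have "?y \<in> E" by (rule truncate_above_in_E[OF yL])
  then obtain w where w: "w \<in> E" "\<And>s. 0 \<le> s \<Longrightarrow> distribution w s = of_nat k * distribution ?y s"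
    using copies[OF y, of k] by blast
  have "?\<chi> \<in> E \<and> N ?\<chi> \<le> N w"
  proof (rule distribution_dominated[OF w(1)])
    show "?\<chi> \<in> borel_measurable semiaxis"
      by (intro borel_measurable_indicator) (auto simp: sets_restrict_space_iff)
    fix s :: real assume s: "0 \<le> s"
    show "distribution ?\<chi> s \<le> distribution w s"
    proof (cases "s < 1")
      case True
      have "{t \<in> space semiaxis. \<bar>?\<chi> t\<bar> > s} = {t \<in> space semiaxis. 0 < t \<and> ennreal (t - 0) < 1}"
        using True s by (auto simp: indicator_def ennreal_less_one_iff)
      then have "distribution ?\<chi> s = 1"
        unfolding distribution_def by (simp only: emeasure_semiaxis_interval[OF order_refl])
      also have "1 \<le> ennreal (real k * d)" using k d by (simp add: field_simps)
      also have "\<dots> = of_nat k * distribution ?y s"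
        using dy[OF s] True d c by (simp add: ennreal_mult ennreal_of_nat_eq_real_of_nat max_def)
      finally show ?thesis using w(2)[OF s] by simp
    next
      case False
      then have "{t \<in> space semiaxis. \<bar>?\<chi> t\<bar> > s} = {}" by (auto simp: indicator_def)
      then have "distribution ?\<chi> s = 0" unfolding distribution_def by (simp only: emeasure_empty)
      then show ?thesis by simp
    qed
  qed
  then show ?thesis by simp
qed

text \<open>
  The dilated rearrangement is split at the level \<open>Q S\<close>: above it \<open>Q U\<close> dominates the distribution
  function, and below it the function is at most \<open>Q S\<close> on the unit interval.
\<close>

lemma dilated_rearr_norm_le:
  assumes x: "x \<in> E" and \<chi>: "indicator {0<..<1} \<in> E" and U: "U \<in> E" and S: "0 < S"
    and Q: "0 < Q" and m: "0 < m"
    and le: "\<And>s. 0 \<le> s \<Longrightarrow> of_nat m * distribution x (real Q * max s S) \<le> distribution U s"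
  shows "N (dilated_rearr x m) \<le> real Q * (N U + S * N (indicator {0<..<1}))"
proof -
  note xL = E_L1[OF x]
  \<comment> \<open>Scaling \<open>U\<close> by \<open>Q\<close> moves its truncation level \<open>S\<close> to \<open>T\<close>.\<close>
  define T where "T = real Q * S"
  have T: "0 < T" using S Q by (simp add: T_def)
  let ?g = "dilated_rearr x m" and ?\<chi> = "\<lambda>t. T * indicator {0<..<1} t"
  let ?h = "truncate_above T ?g"
  note g = dilated_rearr_subhomogeneous(1)[OF x m]
  note hm = L1_measurable[OF truncate_above_L1[OF E_L1[OF g]]]
  have QU: "(\<lambda>t. real Q * U t) \<in> E" by (rule E_scale[OF U])
  have h: "?h \<in> E \<and> N ?h \<le> N (\<lambda>t. real Q * U t)"
  proof (rule distribution_dominated[OF QU hm])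
    fix s :: real assume s: "0 \<le> s"
    have "real Q * max (s / real Q) S = max s T" using Q by (simp add: T_def max_mult_distrib_left)
    then have "of_nat m * distribution x (max s T) \<le> distribution U (s / real Q)"
      using le[of "s / real Q"] s by simp
    moreover have "distribution ?h s \<le> of_nat m * distribution x (max s T)"
      using s distribution_dilated_rearr[OF xL m, of "max s T"] by (simp add: distribution_truncate_above)
    ultimately show "distribution ?h s \<le> distribution (\<lambda>t. real Q * U t) s"
      using Q by (simp add: distribution_scale)
  qed
  have \<chi>T: "?\<chi> \<in> E" by (rule E_scale[OF \<chi>])
  have "AE t in semiaxis. 0 \<le> ?g t \<and> ?g t \<le> ?h t + ?\<chi> t"
  proof (rule AE_I2)
    fix t assume "t \<in> space semiaxis"
    then have "0 \<le> ?g t" using dilated_rearr_nonneg[OF xL m] by simp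
    moreover have "t \<notin> {0<..<1} \<Longrightarrow> ?g t = 0" by (simp add: dilated_rearr_def)
    ultimately show "0 \<le> ?g t \<and> ?g t \<le> ?h t + ?\<chi> t"
      using T by (auto simp: truncate_above_def indicator_def)
  qed
  then have "N ?g \<le> N (\<lambda>t. ?h t + ?\<chi> t)"
    using order_ideal[OF E_add[OF conjunct1[OF h] \<chi>T] E_measurable[OF g]] by blast
  also have "\<dots> \<le> N ?h + N ?\<chi>" by (rule N_triangle[OF conjunct1[OF h] \<chi>T])
  also have "N ?\<chi> = T * N (indicator {0<..<1})" using N_scale[OF \<chi>, of T] T by simp
  also have "N ?h \<le> real Q * N U" using h N_scale[OF U, of "real Q"] by simp
  finally show ?thesis by (simp add: T_def algebra_simps)
qed

end

section \<open>A geometric sequence of levels\<close>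

lemma sum_positive_part_le:
  fixes b :: "nat \<Rightarrow> real"
  assumes "\<And>i. i < n \<Longrightarrow> 0 \<le> b i" "0 \<le> s"
  shows "(\<Sum>i<n. max 0 (b i - s)) \<le> max 0 ((\<Sum>i<n. b i) - s)"
  using assms(1)
proof (induction n)
  case (Suc n)
  have "0 \<le> (\<Sum>i<n. b i)" "0 \<le> b n" using Suc.prems by (auto intro: sum_nonneg)
  then have "max 0 ((\<Sum>i<n. b i) - s) + max 0 (b n - s) \<le> max 0 ((\<Sum>i<n. b i) + b n - s)"
    using assms(2) by (simp add: max_def)
  moreover have "(\<Sum>i<n. max 0 (b i - s)) \<le> max 0 ((\<Sum>i<n. b i) - s)"
    using Suc by simp
  ultimately show ?case by simp
qed simp

text \<open>
  If \<open>y\<close> exceeds the level \<open>q\<^sup>r\<^sup>+\<^sup>1 s\<close>, it exceeds all lower ones, and the weights of the levels sum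
  to at most \<open>q\<^sup>r\<^sup>+\<^sup>1 s - s\<close> since \<open>q \<ge> 2\<close>.
\<close>

lemma geometric_levels_le:
  fixes y s :: real and q :: nat
  assumes q: "2 \<le> q" and s: "0 < s" and y: "0 \<le> y"
  shows "(\<Sum>i\<le>r. s * real (q ^ i) * (if y > real (q ^ i) * (real q * s) then 1 else 0)) \<le> max 0 (y - s)"
proof (induction r)
  case 0
  have "2 * s \<le> real q * s" using q s by (intro mult_right_mono) auto
  then show ?case by (auto simp: max_def)
next
  case (Suc r)
  show ?case
  proof (cases "y > real (q ^ Suc r) * (real q * s)")
    case False
    then show ?thesis using Suc.IH by simp
  next
    case True
    have "(\<Sum>i\<le>j. real (q ^ i)) \<le> real (q ^ Suc j) - 1" for j
    proof (induction j)
      case 0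
      show ?case using q by simp
    next
      case (Suc j)
      have "2 * real (q ^ Suc j) \<le> real q * real (q ^ Suc j)"
        using q by (intro mult_right_mono) auto
      then show ?case using Suc by simp
    qed
    then have "s * (\<Sum>i\<le>Suc r. real (q ^ i)) \<le> s * (real (q ^ Suc (Suc r)) - 1)"
      using s by (intro mult_left_mono) (simp_all only: less_imp_le)
    also have "\<dots> \<le> y - s" using True by (simp add: algebra_simps)
    finally have "s * (\<Sum>i\<le>Suc r. real (q ^ i)) \<le> max 0 (y - s)" by simp
    moreover have "(\<Sum>i\<le>Suc r. s * real (q ^ i) * (if y > real (q ^ i) * (real q * s) then 1 else 0))
        \<le> s * (\<Sum>i\<le>Suc r. real (q ^ i))"
      unfolding sum_distrib_left by (rule sum_mono) (use s in auto)
    ultimately show ?thesis by linarith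
  qed
qed

lemma tail_integral_finite:
  assumes "u \<in> L1" "0 \<le> s"
  shows "tail_integral u s < \<infinity>"
proof -
  have "tail_integral u s \<le> (\<integral>\<^sup>+ t. ennreal \<bar>u t\<bar> \<partial>semiaxis)"
    unfolding tail_integral_def by (rule nn_integral_mono) (use assms in \<open>auto intro: ennreal_leI\<close>)
  then show ?thesis using assms(1) L1_nn_integral[OF L1_measurable[OF assms(1)]] by (simp add: le_less_trans)
qed

lemma tail_integral_cong:
  assumes "equimeasurable u v" "u \<in> L1" "v \<in> L1" "0 \<le> s"
  shows "tail_integral u s = tail_integral v s"
  by (intro antisym tail_integral_mono L1_measurable)
    (use assms equimeasurableD[OF assms(1-3)] in auto)

lemma ennreal_max_zero: "ennreal (max 0 y) = ennreal y"
  by (cases "0 \<le> y") (auto simp: ennreal_neg max_def)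

text \<open>
  Lowering the level from \<open>s\<close> to \<open>\<sigma>\<close> adds at most \<open>s\<close> to the integrand, and only where \<open>|u| > \<sigma>\<close>.
\<close>

lemma tail_integral_gap:
  assumes u: "u \<in> borel_measurable semiaxis" and "0 \<le> \<sigma>" "\<sigma> \<le> s"
  shows "tail_integral u \<sigma> \<le> tail_integral u s + ennreal s * distribution u \<sigma>"
proof -
  have m: "(\<lambda>t. ennreal (\<bar>u t\<bar> - s)) \<in> borel_measurable semiaxis" using u by measurable
  have "tail_integral u \<sigma> \<le> (\<integral>\<^sup>+ t. ennreal (\<bar>u t\<bar> - s)
      + ennreal s * indicator {t \<in> space semiaxis. \<bar>u t\<bar> > \<sigma>} t \<partial>semiaxis)"
    unfolding tail_integral_def
  proof (rule nn_integral_mono)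
    fix t assume t: "t \<in> space semiaxis"
    have "\<bar>u t\<bar> - \<sigma> \<le> max 0 (\<bar>u t\<bar> - s) + s" using assms by simp
    then have "ennreal (\<bar>u t\<bar> - \<sigma>) \<le> ennreal (max 0 (\<bar>u t\<bar> - s)) + ennreal s"
      using assms by (subst ennreal_plus[symmetric]) (auto intro!: ennreal_leI simp del: ennreal_plus)
    then show "ennreal (\<bar>u t\<bar> - \<sigma>) \<le> ennreal (\<bar>u t\<bar> - s)
        + ennreal s * indicator {t \<in> space semiaxis. \<bar>u t\<bar> > \<sigma>} t"
      using t by (auto simp: indicator_def ennreal_neg ennreal_max_zero)
  qed
  also have "\<dots> = tail_integral u s + ennreal s * distribution u \<sigma>"
    unfolding tail_integral_def distribution_def
    by (subst nn_integral_add[OF m]) (use sets_superlevel[OF u] in \<open>auto simp: nn_integral_cmult_indicator\<close>)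
  finally show ?thesis .
qed

lemma tail_integral_ge_levels:
  fixes q r :: nat
  assumes x: "x \<in> borel_measurable semiaxis" and q: "2 \<le> q" and s: "0 < s"
  shows "ennreal s * (\<Sum>i\<le>r. of_nat (q ^ i) * distribution x (real (q ^ i) * (real q * s))) \<le> tail_integral x s"
proof -
  let ?L = "\<lambda>i. {t \<in> space semiaxis. \<bar>x t\<bar> > real (q ^ i) * (real q * s)}"
  have "ennreal s * (\<Sum>i\<le>r. of_nat (q ^ i) * distribution x (real (q ^ i) * (real q * s)))
      = (\<Sum>i\<le>r. ennreal (s * real (q ^ i)) * distribution x (real (q ^ i) * (real q * s)))"
    using s by (simp only: sum_distrib_left ennreal_of_nat_eq_real_of_nat mult.assoc[symmetric] ennreal_mult less_imp_le of_nat_0_le_iff)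
  also have "\<dots> = (\<Sum>i\<le>r. \<integral>\<^sup>+ t. ennreal (s * real (q ^ i)) * indicator (?L i) t \<partial>semiaxis)"
    unfolding distribution_def
    by (intro sum.cong refl nn_integral_cmult_indicator[symmetric] sets_superlevel[OF x])
  also have "\<dots> = (\<integral>\<^sup>+ t. (\<Sum>i\<le>r. ennreal (s * real (q ^ i)) * indicator (?L i) t) \<partial>semiaxis)"
    by (rule nn_integral_sum[symmetric])
      (intro borel_measurable_times_ennreal borel_measurable_const borel_measurable_indicator sets_superlevel[OF x])
  also have "\<dots> \<le> tail_integral x s"
    unfolding tail_integral_def
  proof (rule nn_integral_mono)
    fix t assume t: "t \<in> space semiaxis"
    have "(\<Sum>i\<le>r. ennreal (s * real (q ^ i)) * indicator (?L i) t)
       = (\<Sum>i\<le>r. ennreal (s * real (q ^ i) * (if \<bar>x t\<bar> > real (q ^ i) * (real q * s) then 1 else 0)))"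
      by (rule sum.cong[OF refl]) (use t in \<open>auto simp: indicator_def\<close>)
    also have "\<dots> = ennreal (\<Sum>i\<le>r. s * real (q ^ i) * (if \<bar>x t\<bar> > real (q ^ i) * (real q * s) then 1 else 0))"
      by (rule sum_ennreal) (use s in auto)
    also have "\<dots> \<le> ennreal (max 0 (\<bar>x t\<bar> - s))"
      by (rule ennreal_leI[OF geometric_levels_le[OF q s]]) simp
    also have "\<dots> = ennreal (\<bar>x t\<bar> - s)" by (rule ennreal_max_zero)
    finally show "(\<Sum>i\<le>r. ennreal (s * real (q ^ i)) * indicator (?L i) t) \<le> ennreal (\<bar>x t\<bar> - s)" .
  qed
  finally show ?thesis .
qed

text \<open>
  The map \<open>y \<mapsto> max 0 (y - s)\<close> is superadditive on nonnegative numbers, whereas \<open>n\<close> summands can only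
  exceed \<open>s\<close> together by what they exceed \<open>s/n\<close> separately. So the identity in the assumptions bounds
  the integrals of \<open>x\<close> and \<open>v\<^sub>i\<close> above \<open>s = q \<sigma>\<close> by those of \<open>u\<^sub>i\<close> above \<open>\<sigma>\<close>; the choice \<open>q = n + 2\<close> leaves
  room for the bounded term \<open>z\<close> and guarantees \<open>q \<ge> 2\<close>. The integrals of \<open>v\<^sub>i\<close> and \<open>u\<^sub>i\<close> above \<open>s\<close> agree
  and cancel, up to the gap between the levels \<open>\<sigma>\<close> and \<open>s\<close>.
\<close>

lemma levels_le_of_balance:
  fixes n r :: nat
  assumes x: "x \<in> L1" "AE t in semiaxis. 0 \<le> x t"
    and u: "\<And>i. i < n \<Longrightarrow> u i \<in> L1" "\<And>i. i < n \<Longrightarrow> AE t in semiaxis. 0 \<le> u i t"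
    and v: "\<And>i. i < n \<Longrightarrow> v i \<in> L1" "\<And>i. i < n \<Longrightarrow> AE t in semiaxis. 0 \<le> v i t"
    and uv: "\<And>i. i < n \<Longrightarrow> equimeasurable (v i) (u i)"
    and z: "AE t in semiaxis. \<bar>z t\<bar> \<le> C" and \<sigma>: "0 < \<sigma>" "C \<le> \<sigma>"
    and balance: "AE t in semiaxis. x t + (\<Sum>i<n. v i t) = (\<Sum>i<n. u i t) + z t"
  defines "q \<equiv> n + 2"
  shows "(\<Sum>i\<le>r. of_nat (q ^ i) * distribution x (real (q ^ i) * (real q ^ 2 * \<sigma>)))
    \<le> (\<Sum>i<n. distribution (u i) \<sigma>)"
proof -
  define s where "s = real q * \<sigma>"
  have s: "0 < s" "\<sigma> \<le> s" using \<sigma> by (auto simp: s_def q_def algebra_simps add_nonneg_pos)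
  have "AE t in semiaxis. \<forall>i<n. 0 \<le> u i t" "AE t in semiaxis. \<forall>i<n. 0 \<le> v i t"
    using u(2) v(2) by (auto simp: AE_all_countable)
  with x(2) z balance
  have "AE t in semiaxis. ennreal (\<bar>x t\<bar> - s) + (\<Sum>i<n. ennreal (\<bar>v i t\<bar> - s)) \<le> (\<Sum>i<n. ennreal (\<bar>u i t\<bar> - \<sigma>))"
  proof eventually_elim
    fix t assume x0: "0 \<le> x t" and zt: "\<bar>z t\<bar> \<le> C" and bal: "x t + (\<Sum>i<n. v i t) = (\<Sum>i<n. u i t) + z t"
      and u0: "\<forall>i<n. 0 \<le> u i t" and v0: "\<forall>i<n. 0 \<le> v i t"
    have "(\<Sum>i<n. max 0 (v i t - s)) \<le> max 0 ((\<Sum>i<n. v i t) - s)"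
      using v0 s by (intro sum_positive_part_le) auto
    moreover have "0 \<le> (\<Sum>i<n. v i t)" using v0 by (auto intro: sum_nonneg)
    ultimately have 1: "max 0 (x t - s) + (\<Sum>i<n. max 0 (v i t - s)) \<le> max 0 (x t + (\<Sum>i<n. v i t) - s)"
      using x0 s by (auto simp: max_def split: if_splits)
    have "(\<Sum>i<n. u i t) \<le> (\<Sum>i<n. max 0 (u i t - \<sigma>) + \<sigma>)" by (rule sum_mono) simp
    also have "\<dots> = (\<Sum>i<n. max 0 (u i t - \<sigma>)) + real n * \<sigma>" by (simp add: sum.distrib)
    finally have "x t + (\<Sum>i<n. v i t) - s \<le> (\<Sum>i<n. max 0 (u i t - \<sigma>))"
      using bal zt \<sigma> by (simp add: s_def q_def algebra_simps)
    moreover have "0 \<le> (\<Sum>i<n. max 0 (u i t - \<sigma>))" by (rule sum_nonneg) simp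
    ultimately have 2: "max 0 (x t - s) + (\<Sum>i<n. max 0 (v i t - s)) \<le> (\<Sum>i<n. max 0 (u i t - \<sigma>))"
      using 1 by simp
    have "ennreal (\<bar>x t\<bar> - s) + (\<Sum>i<n. ennreal (\<bar>v i t\<bar> - s))
        = ennreal (max 0 (x t - s)) + (\<Sum>i<n. ennreal (max 0 (v i t - s)))"
      using x0 v0 by (intro arg_cong2[where f = "(+)"] sum.cong) (auto simp: ennreal_max_zero)
    also have "\<dots> = ennreal (max 0 (x t - s) + (\<Sum>i<n. max 0 (v i t - s)))"
      by (subst sum_ennreal) (auto intro!: ennreal_plus[symmetric] sum_nonneg)
    also have "\<dots> \<le> ennreal (\<Sum>i<n. max 0 (u i t - \<sigma>))" by (rule ennreal_leI[OF 2])
    also have "\<dots> = (\<Sum>i<n. ennreal (max 0 (u i t - \<sigma>)))" by (rule sum_ennreal[symmetric]) simp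
    also have "\<dots> = (\<Sum>i<n. ennreal (\<bar>u i t\<bar> - \<sigma>))"
      using u0 by (intro sum.cong) (auto simp: ennreal_max_zero)
    finally show "ennreal (\<bar>x t\<bar> - s) + (\<Sum>i<n. ennreal (\<bar>v i t\<bar> - s)) \<le> (\<Sum>i<n. ennreal (\<bar>u i t\<bar> - \<sigma>))" .
  qed
  then have int: "(\<integral>\<^sup>+ t. ennreal (\<bar>x t\<bar> - s) + (\<Sum>i<n. ennreal (\<bar>v i t\<bar> - s)) \<partial>semiaxis)
      \<le> (\<integral>\<^sup>+ t. (\<Sum>i<n. ennreal (\<bar>u i t\<bar> - \<sigma>)) \<partial>semiaxis)"
    by (rule nn_integral_mono_AE)
  have m: "(\<lambda>t. ennreal (\<bar>w t\<bar> - c)) \<in> borel_measurable semiaxis" if "w \<in> L1" for w c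
    using L1_measurable[OF that] by measurable
  have "(\<integral>\<^sup>+ t. ennreal (\<bar>x t\<bar> - s) + (\<Sum>i<n. ennreal (\<bar>v i t\<bar> - s)) \<partial>semiaxis)
      = tail_integral x s + (\<Sum>i<n. tail_integral (v i) s)"
    unfolding tail_integral_def
    by (subst nn_integral_add) (auto intro!: m x v borel_measurable_sum nn_integral_sum)
  also have "(\<Sum>i<n. tail_integral (v i) s) = (\<Sum>i<n. tail_integral (u i) s)"
    using s by (intro sum.cong refl tail_integral_cong uv u v) auto
  moreover have "(\<integral>\<^sup>+ t. (\<Sum>i<n. ennreal (\<bar>u i t\<bar> - \<sigma>)) \<partial>semiaxis) = (\<Sum>i<n. tail_integral (u i) \<sigma>)"
    unfolding tail_integral_def by (rule nn_integral_sum) (auto intro!: m u)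
  ultimately have "tail_integral x s + (\<Sum>i<n. tail_integral (u i) s) \<le> (\<Sum>i<n. tail_integral (u i) \<sigma>)"
    using int by simp
  also have "\<dots> \<le> (\<Sum>i<n. tail_integral (u i) s + ennreal s * distribution (u i) \<sigma>)"
    using \<sigma> s by (intro sum_mono tail_integral_gap L1_measurable u) auto
  also have "\<dots> = (\<Sum>i<n. tail_integral (u i) s) + ennreal s * (\<Sum>i<n. distribution (u i) \<sigma>)"
    by (simp add: sum.distrib sum_distrib_left)
  finally have "(\<Sum>i<n. tail_integral (u i) s) + tail_integral x s
      \<le> (\<Sum>i<n. tail_integral (u i) s) + ennreal s * (\<Sum>i<n. distribution (u i) \<sigma>)"
    by (simp add: add.commute)
  moreover have "(\<Sum>i<n. tail_integral (u i) s) < \<infinity>"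
    using tail_integral_finite[OF u(1)] s by (simp add: ennreal_sum_less_top)
  ultimately have "tail_integral x s \<le> ennreal s * (\<Sum>i<n. distribution (u i) \<sigma>)"
    unfolding ennreal_add_left_cancel_le by (metis infinity_ennreal_def less_irrefl)
  moreover have "ennreal s * (\<Sum>i\<le>r. of_nat (q ^ i) * distribution x (real (q ^ i) * (real q * s))) \<le> tail_integral x s"
    by (rule tail_integral_ge_levels[OF L1_measurable[OF x(1)] _ s(1)]) (simp add: q_def)
  ultimately have "ennreal s * (\<Sum>i\<le>r. of_nat (q ^ i) * distribution x (real (q ^ i) * (real q * s)))
      \<le> ennreal s * (\<Sum>i<n. distribution (u i) \<sigma>)" by (rule order_trans[rotated])
  then have "(\<Sum>i\<le>r. of_nat (q ^ i) * distribution x (real (q ^ i) * (real q * s))) \<le> (\<Sum>i<n. distribution (u i) \<sigma>)"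
    using s(1) by (simp add: ennreal_mult_le_mult_iff)
  moreover have "real q * s = real q ^ 2 * \<sigma>" by (simp add: s_def power2_eq_square)
  ultimately show ?thesis by simp
qed

section \<open>A subspace on which the limit vanishes\<close>

lemma Linf_add:
  assumes "u \<in> Linf" "v \<in> Linf" shows "(\<lambda>t. u t + v t) \<in> Linf"
proof -
  obtain C D where "AE t in semiaxis. \<bar>u t\<bar> \<le> C" "AE t in semiaxis. \<bar>v t\<bar> \<le> D"
    using assms by (auto simp: Linf_def)
  then have "AE t in semiaxis. \<bar>u t + v t\<bar> \<le> C + D" by eventually_elim linarith
  then show ?thesis using assms by (auto simp: Linf_def)
qed

lemma Linf_scale:
  assumes "u \<in> Linf" shows "(\<lambda>t. c * u t) \<in> Linf"
proof -
  obtain C where "AE t in semiaxis. \<bar>u t\<bar> \<le> C"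
    using assms by (auto simp: Linf_def)
  then have "AE t in semiaxis. \<bar>c * u t\<bar> \<le> \<bar>c\<bar> * C"
    by eventually_elim (simp add: abs_mult mult_left_mono)
  then show ?thesis using assms by (auto simp: Linf_def)
qed

lemma equimeasurable_scale:
  assumes "equimeasurable u v" "u \<in> L1" "v \<in> L1" "0 \<le> c"
  shows "equimeasurable (\<lambda>t. c * u t) (\<lambda>t. c * v t)"
proof (cases "c = 0")
  case False
  with assms(4) have "0 < c" by simp
  then show ?thesis
    by (intro equimeasurableI) (simp add: distribution_scale equimeasurableD[OF assms(1-3)])
qed (simp add: equimeasurable_def)

lemma equimeasurable_sym: "equimeasurable u v \<Longrightarrow> equimeasurable v u"
  by (simp add: equimeasurable_def)

context symmetric_space_in_L1
begin

text \<open>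
  Functions that every symmetric singular linear functional annihilates for evident reasons, written
  without scalars and signs: scalars are absorbed into \<open>u\<close> and \<open>v\<close>, and a negative sign exchanges the two.
\<close>

definition balanced :: "(real \<Rightarrow> real) \<Rightarrow> bool" where
  "balanced w \<longleftrightarrow> (\<exists>(n::nat) u v. \<exists>z \<in> E \<inter> (L1 \<inter> Linf).
     (\<forall>i<n. u i \<in> E \<and> v i \<in> E \<and> (AE t in semiaxis. 0 \<le> u i t) \<and> (AE t in semiaxis. 0 \<le> v i t) \<and>
        equimeasurable (v i) (u i)) \<and>
     (\<forall>t. w t + (\<Sum>i<n. v i t) = (\<Sum>i<n. u i t) + z t))"

lemma balancedI:
  fixes n :: nat
  assumes "z \<in> E \<inter> (L1 \<inter> Linf)"
    and "\<And>i. i < n \<Longrightarrow> u i \<in> E \<and> v i \<in> E \<and> (AE t in semiaxis. 0 \<le> u i t) \<and> (AE t in semiaxis. 0 \<le> v i t) \<and>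
        equimeasurable (v i) (u i)"
    and "\<And>t. w t + (\<Sum>i<n. v i t) = (\<Sum>i<n. u i t) + z t"
  shows "balanced w"
  unfolding balanced_def using assms by blast

lemma balancedE:
  assumes "balanced w"
  obtains n :: nat and u v z where "z \<in> E \<inter> (L1 \<inter> Linf)"
    "\<And>i. i < n \<Longrightarrow> u i \<in> E \<and> v i \<in> E \<and> (AE t in semiaxis. 0 \<le> u i t) \<and> (AE t in semiaxis. 0 \<le> v i t) \<and>
        equimeasurable (v i) (u i)"
    "\<And>t. w t + (\<Sum>i<n. v i t) = (\<Sum>i<n. u i t) + z t"
  using assms unfolding balanced_def by blast

lemma bounded_part_add:
  "u \<in> E \<inter> (L1 \<inter> Linf) \<Longrightarrow> v \<in> E \<inter> (L1 \<inter> Linf) \<Longrightarrow> (\<lambda>t. u t + v t) \<in> E \<inter> (L1 \<inter> Linf)"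
  by (auto intro: E_add L1_add Linf_add)

lemma bounded_part_scale:
  "u \<in> E \<inter> (L1 \<inter> Linf) \<Longrightarrow> (\<lambda>t. c * u t) \<in> E \<inter> (L1 \<inter> Linf)"
  by (auto intro: E_scale L1_scale Linf_scale)

lemma balanced_bounded: "z \<in> E \<inter> (L1 \<inter> Linf) \<Longrightarrow> balanced z"
  unfolding balanced_def by (intro exI[of _ 0] exI bexI[of _ z]) auto

lemma zero_bounded: "(\<lambda>t. 0) \<in> E \<inter> (L1 \<inter> Linf)"
  using E_zero by (auto simp: L1_def Linf_def)

lemma balanced_diff:
  assumes "u \<in> E" "v \<in> E" "AE t in semiaxis. 0 \<le> u t" "AE t in semiaxis. 0 \<le> v t" "equimeasurable v u"
  shows "balanced (\<lambda>t. u t - v t)"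
  unfolding balanced_def
  by (intro exI[of _ "1::nat"] exI[of _ "\<lambda>_. u"] exI[of _ "\<lambda>_. v"] bexI[OF _ zero_bounded])
    (use assms in auto)

lemma balanced_add:
  assumes "balanced w" "balanced w'"
  shows "balanced (\<lambda>t. w t + w' t)"
proof -
  obtain n :: nat and u v z where 1: "z \<in> E \<inter> (L1 \<inter> Linf)"
    "\<And>i. i < n \<Longrightarrow> u i \<in> E \<and> v i \<in> E \<and> (AE t in semiaxis. 0 \<le> u i t) \<and> (AE t in semiaxis. 0 \<le> v i t) \<and>
        equimeasurable (v i) (u i)"
    "\<And>t. w t + (\<Sum>i<n. v i t) = (\<Sum>i<n. u i t) + z t"
    by (rule balancedE[OF assms(1)]) (rule that)
  obtain n' :: nat and u' v' z' where 2: "z' \<in> E \<inter> (L1 \<inter> Linf)"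
    "\<And>i. i < n' \<Longrightarrow> u' i \<in> E \<and> v' i \<in> E \<and> (AE t in semiaxis. 0 \<le> u' i t) \<and> (AE t in semiaxis. 0 \<le> v' i t) \<and>
        equimeasurable (v' i) (u' i)"
    "\<And>t. w' t + (\<Sum>i<n'. v' i t) = (\<Sum>i<n'. u' i t) + z' t"
    by (rule balancedE[OF assms(2)]) (rule that)
  let ?u = "\<lambda>i. if i < n then u i else u' (i - n)" and ?v = "\<lambda>i. if i < n then v i else v' (i - n)"
  have split: "(\<Sum>i<n + n'. (if i < n then a i else b (i - n)) t) = (\<Sum>i<n. a i t) + (\<Sum>i<n'. b i t)"
    for a b :: "nat \<Rightarrow> real \<Rightarrow> real" and t
    by (induction n') auto
  show ?thesis
  proof (rule balancedI[OF bounded_part_add[OF 1(1) 2(1)], where n = "n + n'" and u = ?u and v = ?v])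
    fix t
    show "w t + w' t + (\<Sum>i<n + n'. ?v i t) = (\<Sum>i<n + n'. ?u i t) + (z t + z' t)"
      using 1(3)[of t] 2(3)[of t] unfolding split by linarith
  qed (use 1(2) 2(2) in auto)
qed

lemma balanced_scale:
  assumes "balanced w"
  shows "balanced (\<lambda>t. c * w t)"
proof -
  obtain n :: nat and u v z where 1: "z \<in> E \<inter> (L1 \<inter> Linf)"
    "\<And>i. i < n \<Longrightarrow> u i \<in> E \<and> v i \<in> E \<and> (AE t in semiaxis. 0 \<le> u i t) \<and> (AE t in semiaxis. 0 \<le> v i t) \<and>
        equimeasurable (v i) (u i)"
    and eq: "\<And>t. w t + (\<Sum>i<n. v i t) = (\<Sum>i<n. u i t) + z t"
    by (rule balancedE[OF assms]) (rule that)
  define a b where "a = (if 0 \<le> c then u else v)" and "b = (if 0 \<le> c then v else u)"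
  have ab: "a i \<in> E" "b i \<in> E" "AE t in semiaxis. 0 \<le> a i t" "AE t in semiaxis. 0 \<le> b i t"
      "equimeasurable (b i) (a i)" if "i < n" for i
    using 1(2)[OF that] equimeasurable_sym by (auto simp: a_def b_def)
  let ?a = "\<lambda>i t. \<bar>c\<bar> * a i t" and ?b = "\<lambda>i t. \<bar>c\<bar> * b i t"
  show ?thesis
  proof (rule balancedI[OF bounded_part_scale[OF 1(1), of c], where n = n and u = ?a and v = ?b])
    fix i assume i: "i < n"
    have "?a i \<in> E" "?b i \<in> E" using ab(1,2)[OF i] by (auto intro: E_scale)
    moreover have "AE t in semiaxis. 0 \<le> ?a i t" using ab(3)[OF i] by eventually_elim simp
    moreover have "AE t in semiaxis. 0 \<le> ?b i t" using ab(4)[OF i] by eventually_elim simp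
    moreover have "equimeasurable (?b i) (?a i)"
      by (rule equimeasurable_scale[OF ab(5)[OF i]]) (use ab(1,2)[OF i] E_L1 in auto)
    ultimately show "?a i \<in> E \<and> ?b i \<in> E \<and> (AE t in semiaxis. 0 \<le> ?a i t) \<and>
        (AE t in semiaxis. 0 \<le> ?b i t) \<and> equimeasurable (?b i) (?a i)" by blast
  next
    fix t
    have "c * (w t + (\<Sum>i<n. v i t)) = c * ((\<Sum>i<n. u i t) + z t)" using eq by simp
    then show "c * w t + (\<Sum>i<n. ?b i t) = (\<Sum>i<n. ?a i t) + c * z t"
      unfolding sum_distrib_left[symmetric] by (cases "0 \<le> c") (auto simp: a_def b_def algebra_simps)
  qed
qed

text \<open>
  The function \<open>Y\<close> is the disjoint sum of the \<open>q\<^sup>2 u\<^sub>i\<close>, restricted to large values in order to have supports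
  of finite measure.
\<close>

lemma balanced_levels_le:
  assumes x: "x \<in> E" "AE t in semiaxis. 0 \<le> x t" and bal: "balanced x"
  shows "\<exists>(q::nat) S. \<exists>Y\<in>E. 0 < q \<and> 0 < S \<and> (\<forall>r. \<forall>s\<ge>0.
    (\<Sum>i\<le>r. of_nat (q ^ i) * distribution x (real (q ^ i) * max s S)) \<le> distribution Y s)"
proof -
  obtain n :: nat and u v z where z: "z \<in> E \<inter> (L1 \<inter> Linf)"
    and uv: "\<And>i. i < n \<Longrightarrow> u i \<in> E \<and> v i \<in> E \<and> (AE t in semiaxis. 0 \<le> u i t) \<and> (AE t in semiaxis. 0 \<le> v i t) \<and>
        equimeasurable (v i) (u i)"
    and eq: "\<And>t. x t + (\<Sum>i<n. v i t) = (\<Sum>i<n. u i t) + z t"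
    by (rule balancedE[OF bal]) (rule that)
  obtain C0 where C0: "AE t in semiaxis. \<bar>z t\<bar> \<le> C0" using z by (auto simp: Linf_def)
  \<comment> \<open>A positive bound, since the levels below have to be positive.\<close>
  define C where "C = max C0 1"
  have C: "0 < C" "AE t in semiaxis. \<bar>z t\<bar> \<le> C" using C0 by (auto simp: C_def elim: eventually_mono)
  define q where "q = n + 2"
  \<comment> \<open>The bound on the levels is available at \<open>q\<^sup>2 \<sigma>\<close> for \<open>\<sigma> \<ge> C\<close>.\<close>
  define S where "S = real q ^ 2 * C"
  have q: "0 < q" "0 < real q ^ 2" and S: "0 < S" using C by (auto simp: q_def S_def)
  define y where "y i = (\<lambda>t. real q ^ 2 * truncate_above C (u i) t)" for i
  have dy: "distribution (y i) s = distribution (u i) (max s S / real q ^ 2)" if "0 \<le> s" for i s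
  proof -
    have "max (s / real q ^ 2) C = max s S / real q ^ 2"
      using q by (simp add: S_def max_def field_simps)
    then show ?thesis
      unfolding y_def using distribution_scale[OF q(2)] that q by (simp add: distribution_truncate_above)
  qed
  have y: "finitely_supported (y i)" "y i \<in> E" if "i < n" for i
  proof -
    have uE: "u i \<in> E" using uv[OF that] by simp
    show yE: "y i \<in> E" unfolding y_def by (intro E_scale truncate_above_in_E uE)
    have "0 < max 0 S / real q ^ 2" using S q by simp
    then show "finitely_supported (y i)"
      using dy[of 0 i] distribution_finite[OF E_L1[OF uE]] E_L1[OF yE] by (simp add: finitely_supported_def)
  qed
  obtain Y where Y: "Y \<in> E" "\<And>s. 0 \<le> s \<Longrightarrow> distribution Y s = (\<Sum>i<n. distribution (y i) s)"
    using disjoint_sum[of "{..<n}" y] y by auto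
  have "(\<Sum>i\<le>r. of_nat (q ^ i) * distribution x (real (q ^ i) * max s S)) \<le> distribution Y s"
    if s: "0 \<le> s" for r s
  proof -
    define \<sigma> where "\<sigma> = max s S / real q ^ 2"
    have \<sigma>: "real q ^ 2 * \<sigma> = max s S" using q by (simp add: \<sigma>_def)
    have "real q ^ 2 * C \<le> real q ^ 2 * \<sigma>" unfolding \<sigma> by (simp add: S_def)
    then have "C \<le> \<sigma>" using q by simp
    then have "(\<Sum>i\<le>r. of_nat (q ^ i) * distribution x (real (q ^ i) * (real q ^ 2 * \<sigma>)))
      \<le> (\<Sum>i<n. distribution (u i) \<sigma>)"
      unfolding q_def using C uv E_L1 eq x
      by (intro levels_le_of_balance[where v = v and z = z and C = C]) auto
    then show ?thesis unfolding \<sigma> using Y(2)[OF s] dy[OF s] by (simp add: \<sigma>_def)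
  qed
  then show ?thesis using q S Y(1) by blast
qed

text \<open>
  By flattening, the infimum of \<open>a\<^sub>m / m\<close> is at most \<open>K / (r + 1)\<close> for every \<open>r\<close>, with \<open>K\<close> independent of \<open>r\<close>.
\<close>

lemma balanced_limit_zero:
  assumes x: "x \<in> E" "AE t in semiaxis. 0 \<le> x t" and bal: "balanced x"
    and L: "0 \<le> L" "\<And>m. 0 < m \<Longrightarrow> L \<le> N (dilated_rearr x m) / real m"
  shows "L = 0"
proof (cases "AE t in semiaxis. x t = 0")
  case True
  then have "N x = 0" using N_eq_0_iff[OF x(1)] by simp
  moreover have "N (dilated_rearr x 1) \<le> N x"
    using distribution_dominated[OF x(1) measurable_dilated_rearr[OF E_L1[OF x(1)], of 1]]
    by (simp add: distribution_dilated_rearr[OF E_L1[OF x(1)]])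
  ultimately show ?thesis using L(1) L(2)[of 1] by simp
next
  case False
  note \<chi> = unit_indicator_in_E[OF x(1) False]
  obtain q S Y where q: "0 < (q::nat)" "0 < S" and Y: "Y \<in> E"
    and le: "\<And>r s. 0 \<le> s \<Longrightarrow> (\<Sum>i\<le>r. of_nat (q ^ i) * distribution x (real (q ^ i) * max s S)) \<le> distribution Y s"
    using balanced_levels_le[OF x bal] by blast
  define K where "K = N Y + S * N (indicator {0<..<1})"
  have bound: "L \<le> K / real (Suc r)" for r
  proof -
    have Q: "0 < q ^ r" using q by simp
    obtain U where U: "U \<in> E" "N U \<le> N Y"
      "\<forall>s\<ge>0. of_nat (Suc r * q ^ r) * distribution x (real (q ^ r) * max s S) \<le> distribution U s"
      using flattening[OF E_L1[OF x(1)] q Y le] by blast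
    have m: "0 < Suc r * q ^ r" using Q by simp
    have "L \<le> N (dilated_rearr x (Suc r * q ^ r)) / real (Suc r * q ^ r)" by (rule L(2)[OF m])
    also have "\<dots> \<le> real (q ^ r) * (N U + S * N (indicator {0<..<1})) / real (Suc r * q ^ r)"
      by (intro divide_right_mono dilated_rearr_norm_le[OF x(1) \<chi> U(1) q(2) Q m]) (use U(3) in auto)
    also have "\<dots> \<le> real (q ^ r) * K / real (Suc r * q ^ r)"
      unfolding K_def using U(2) by (intro divide_right_mono mult_left_mono) auto
    also have "\<dots> = K / real (Suc r)"
      using Q q by (simp only: of_nat_mult mult.commute[of "real (Suc r)"]) (simp del: of_nat_Suc of_nat_power)
    finally show ?thesis .
  qed
  show ?thesis
  proof (rule ccontr)
    assume "L \<noteq> 0"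
    then have L0: "0 < L" using L(1) by simp
    obtain r :: nat where "K / L < real r" using reals_Archimedean2 by blast
    then have "K < L * real (Suc r)" using L0 by (simp add: field_simps)
    then show False using bound[of r] by (simp add: field_simps)
  qed
qed

end

section \<open>Extension of linear functionals\<close>

lemma (in vector_space_pair) linear_functional_separating:
  assumes "x \<notin> vs1.span S"
  shows "\<exists>g. Vector_Spaces.linear s1 s2 g \<and> (\<forall>s\<in>S. g s = 0) \<and> g x = c"
proof -
  obtain B where B: "B \<subseteq> S" "vs1.independent B" "S \<subseteq> vs1.span B"
    by (rule vs1.maximal_independent_subset)
  have "x \<notin> vs1.span B" using assms vs1.span_mono[OF B(1)] by blast
  then have "vs1.independent (insert x B)" by (rule vs1.independent_insertI[OF _ B(2)])
  then obtain g where g: "Vector_Spaces.linear s1 s2 g" "\<forall>y\<in>insert x B. g y = (if y = x then c else 0)"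
    using linear_independent_extend[of "insert x B" "\<lambda>y. if y = x then c else 0"] by blast
  have "x \<notin> B" using \<open>x \<notin> vs1.span B\<close> vs1.span_base by blast
  then have "g y = 0" if "y \<in> B" for y using g(2) that by auto
  then have "g y = 0" if "y \<in> vs1.span B" for y using linear_eq_0_on_span[OF g(1)] that by blast
  then show ?thesis using g B(3) by (intro exI[of _ g]) auto
qed

interpretation fun_space: vector_space "\<lambda>(c::real) (f::real \<Rightarrow> real). (\<lambda>t. c * f t)"
  by standard (auto simp: fun_eq_iff algebra_simps)

interpretation fun_dual: vector_space_pair "\<lambda>(c::real) (f::real \<Rightarrow> real). (\<lambda>t. c * f t)" "(*) :: real \<Rightarrow> real \<Rightarrow> real"
proof (rule vector_space_pair.intro)
  show "vector_space ((*) :: real \<Rightarrow> real \<Rightarrow> real)"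
    unfolding vector_space_def by (simp add: distrib_left distrib_right)
qed (rule fun_space.vector_space_axioms)

theorem theorem28:
  fixes E :: "(real \<Rightarrow> real) set" and N :: "(real \<Rightarrow> real) \<Rightarrow> real" and x :: "real \<Rightarrow> real"
  assumes "symmetric_banach_space E N"
    and "E \<subseteq> L1"
    and "x \<in> E"
    and "AE t in semiaxis. 0 \<le> x t"
  shows "\<exists>\<phi> :: (real \<Rightarrow> real) \<Rightarrow> real.
           linear_functional_on E \<phi> \<and> symmetric_functional_on E \<phi> \<and> singular_functional_on E \<phi> \<and>
           (\<lambda>m::nat. 1 / real m *
              N (\<lambda>t. dilation (real m) (rearr x) t * indicator {0<..<1} t)) \<longlonglongrightarrow> \<phi> x"
proof -
  interpret symmetric_space_in_L1 E N by standard (rule assms(1,2))+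
  obtain L where L: "0 \<le> L" "(\<lambda>m. 1 / real m * N (dilated_rearr x m)) \<longlonglongrightarrow> L"
      "\<And>m. 0 < m \<Longrightarrow> L \<le> N (dilated_rearr x m) / real m"
    using dilated_rearr_limit[OF assms(3)] by blast
  define G where "G = {\<lambda>t. u t - v t |u v. u \<in> E \<and> v \<in> E \<and> (AE t in semiaxis. 0 \<le> u t) \<and>
      (AE t in semiaxis. 0 \<le> v t) \<and> equimeasurable v u} \<union> E \<inter> (L1 \<inter> Linf)"
  have "fun_space.subspace {w. balanced w}"
    unfolding fun_space.subspace_def plus_fun_def zero_fun_def
    using balanced_bounded[OF zero_bounded] balanced_add balanced_scale by blast
  moreover have "G \<subseteq> {w. balanced w}"
    unfolding G_def using balanced_diff balanced_bounded by blast
  ultimately have span: "fun_space.span G \<subseteq> {w. balanced w}"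
    by (intro fun_space.span_minimal)
  have "\<exists>\<phi>. Vector_Spaces.linear (\<lambda>c f t. c * f t) (*) \<phi> \<and> (\<forall>w\<in>G. \<phi> w = 0) \<and> \<phi> x = L"
  proof (cases "x \<in> fun_space.span G")
    case True
    then have "L = 0" using span balanced_limit_zero[OF assms(3,4) _ L(1,3)] by blast
    then show ?thesis by (intro exI[of _ "\<lambda>_. 0"]) (auto intro: fun_dual.linear_zero)
  next
    case False
    then show ?thesis by (rule fun_dual.linear_functional_separating)
  qed
  then obtain \<phi> where \<phi>: "Vector_Spaces.linear (\<lambda>c f t. c * f t) (*) \<phi>" and G0: "\<And>w. w \<in> G \<Longrightarrow> \<phi> w = 0"
    and x: "\<phi> x = L" by blast
  have add: "\<phi> (\<lambda>t. u t + v t) = \<phi> u + \<phi> v" for u v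
    using fun_dual.linear_add[OF \<phi>, of u v] by (simp add: plus_fun_def)
  have scale: "\<phi> (\<lambda>t. c * u t) = c * \<phi> u" for c u
    using fun_dual.linear_scale[OF \<phi>, of c u] by simp
  have diff: "\<phi> u = \<phi> v" if "(\<lambda>t. u t - v t) \<in> G" for u v
    using add[of v "\<lambda>t. u t - v t"] G0[OF that] by simp
  \<comment> \<open>A null function is essentially bounded, so that singularity makes \<open>\<phi>\<close> respect equality almost everywhere.\<close>
  have "\<phi> u = \<phi> v" if "u \<in> E" "v \<in> E" "AE t in semiaxis. u t = v t" for u v
  proof (rule diff)
    have "(\<lambda>t. u t - v t) \<in> E" using E_add[OF that(1) E_scale[OF that(2), of "-1"]] by simp
    moreover have "AE t in semiaxis. \<bar>u t - v t\<bar> \<le> 0" using that(3) by eventually_elim simp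
    ultimately show "(\<lambda>t. u t - v t) \<in> G"
      using E_L1 E_measurable by (auto simp: G_def Linf_def)
  qed
  then have "linear_functional_on E \<phi>"
    unfolding linear_functional_on_def using add scale by blast
  moreover have "symmetric_functional_on E \<phi>"
    unfolding symmetric_functional_on_def
  proof (intro ballI impI, elim conjE)
    fix u v assume "u \<in> E" "v \<in> E" "AE t in semiaxis. 0 \<le> u t" "AE t in semiaxis. 0 \<le> v t" "equimeasurable v u"
    then have "(\<lambda>t. u t - v t) \<in> G" unfolding G_def by blast
    then show "\<phi> v = \<phi> u" using diff by simp
  qed
  moreover have "singular_functional_on E \<phi>"
    unfolding singular_functional_on_def using G0 by (simp add: G_def)
  ultimately show ?thesis using L(2) x unfolding dilated_rearr_def by blast
qed

end
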